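(* For every channel coefficient vector $H=(h_{11},h_{12},h_{21},h_{22})\in\mathbb{C}^4$, the capacity region of the Gaussian interference channel with common information satisfies $\mathbf{C}(H)\subseteq\mathbf{C}_{\rm outer}(H)$, where $\mathbf{C}_{\rm outer}(H)$ is defined below.
   Context: Gaussian interference channel with common information (IC-CI): two transmitters T1, T2 and two receivers R1, R2. At time $t$, $Y_1(t)=h_{11}X_1(t)+h_{12}X_2(t)+Z_1(t)$ and $Y_2(t)=h_{21}X_1(t)+h_{22}X_2(t)+Z_2(t)$, where $X_i(t)\in\mathbb{C}$ is sent by T$i$, $Y_i(t)\in\mathbb{C}$ is received by R$i$, $Z_1(t),Z_2(t)\sim\mathcal{CN}(0,1)$ are noises, i.i.d. over time and independent of the messages, and $H$ is deterministic and known to all terminals. An $(n,R_0,R_1,R_2,P_e^{(n)})$ code consists of: independent messages $\mathcal{M}_0,\mathcal{M}_1,\mathcal{M}_2$, with $\mathcal{M}_k$ uniform on $\{1,\dots,2^{nR_k}\}$ ($\mathcal{M}_0$ is the common message, $\mathcal{M}_i$ the individual message for receiver $i$); encoders $X_i(t)=f_i(\mathcal{M}_0,\mathcal{M}_i,t,H)$, $t=1,\dots,n$, satisfying $\frac1n\sum_{t=1}^n\mathbb{E}|X_i(t)|^2\le 1$, $i=1,2$; decoders $(\hat M_{0i},\hat M_i)=g_i(Y_i^n,H)$ at receiver $i$; and error probability $P_e^{(n)}=\Pr\{\mathcal{M}_1\ne\hat M_1\text{ or }\mathcal{M}_2\ne\hat M_2\text{ or }\mathcal{M}_0\ne\hat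 M_{01}\text{ or }\mathcal{M}_0\ne\hat M_{02}\}$. A triple $(R_0,R_1,R_2)$ is achievable if there is a sequence of such codes with $P_e^{(n)}\to0$; $\mathbf{C}(H)$ is the closure of the set of achievable triples. Let $\mathsf{C}(P)=\log_2(1+P)$. Define $\overline{A}_1=\mathsf{C}\!\left(\frac{|h_{11}|^2}{1+|h_{21}|^2}\right)$, $\overline{A}_2=\mathsf{C}\!\left(\frac{|h_{22}|^2}{1+|h_{12}|^2}\right)$, $\overline{D}_1=\mathsf{C}(|h_{11}|^2)$, $\overline{D}_2=\mathsf{C}(|h_{22}|^2)$, $\overline{E}_1=\mathsf{C}\!\left(|h_{12}|^2+\frac{|h_{11}|^2}{1+|h_{21}|^2}\right)$, $\overline{E}_2=\mathsf{C}\!\left(|h_{21}|^2+\frac{|h_{22}|^2}{1+|h_{12}|^2}\right)$, $\overline{G}_1=\mathsf{C}(|h_{11}|^2+|h_{12}|^2)$, $\overline{G}_2=\mathsf{C}(|h_{22}|^2+|h_{21}|^2)$, $\overline{G}_1'=\mathsf{C}((|h_{11}|+|h_{12}|)^2)$, $\overline{G}_2'=\mathsf{C}((|h_{22}|+|h_{21}|)^2)$. $\mathbf{C}_{\rm outer}(H)$ is the set of $(R_0,R_1,R_2)$ with $R_0,R_1,R_2\ge0$ and $R_0+R_1\le \overline{G}_1'$, $R_0+R_2\le \overline{G}_2'$, $R_1\le \overline{D}_1$, $R_2\le \overline{D}_2$, $R_1+R_2\le \overline{E}_1+\overline{E}_2$, $R_1+R_2\le \overline{A}_1+\overline{G}_2$,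 $R_1+R_2\le \overline{A}_2+\overline{G}_1$, $R_0+R_1+R_2\le \overline{A}_1+\overline{G}_2'$, $R_0+R_1+R_2\le \overline{A}_2+\overline{G}_1'$, $2R_1+R_2\le \overline{A}_1+\overline{G}_1+\overline{E}_2$, $R_1+2R_2\le \overline{A}_2+\overline{G}_2+\overline{E}_1$, $R_0+2R_1+R_2\le \overline{A}_1+\overline{G}_1'+\overline{E}_2$, $R_0+R_1+2R_2\le \overline{A}_2+\overline{G}_2'+\overline{E}_1$. *)

theory Defs
  imports "HOL-Probability.Probability"
begin

text \<open>Gaussian interference channel with common information (IC-CI).
  Time indices are 0..<n (instead of 1..n). Messages are indexed 1..M.\<close>

definition Cap :: "real \<Rightarrow> real" where
  "Cap P = log 2 (1 + P)"

definition msize :: "nat \<Rightarrow> real \<Rightarrow> nat" where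
  "msize n R = nat \<lceil>2 powr (real n * R)\<rceil>"

definition cgauss :: "complex measure" where
  "cgauss = density lborel (\<lambda>z. ennreal (exp (- (cmod z)\<^sup>2) / pi))"

definition noise :: "nat \<Rightarrow> (nat \<Rightarrow> complex \<times> complex) measure" where
  "noise n = PiM {..<n} (\<lambda>_. cgauss \<Otimes>\<^sub>M cgauss)"

definition outspace :: "nat \<Rightarrow> (nat \<Rightarrow> complex) measure" where
  "outspace n = PiM {..<n} (\<lambda>_. (borel :: complex measure))"

text \<open>An (n,R0,R1,R2) code: encoders f_i (common message, private message, time) with the
  average power constraint (expectation over uniform messages), and (measurable) decoders
  g_i mapping a received sequence to an estimate (common message, private message).\<close>
definition is_code ::
  "nat \<Rightarrow> real \<Rightarrow> real \<Rightarrow> real \<Rightarrow>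
   (nat \<Rightarrow> nat \<Rightarrow> nat \<Rightarrow> complex) \<Rightarrow> (nat \<Rightarrow> nat \<Rightarrow> nat \<Rightarrow> complex) \<Rightarrow>
   ((nat \<Rightarrow> complex) \<Rightarrow> nat \<times> nat) \<Rightarrow> ((nat \<Rightarrow> complex) \<Rightarrow> nat \<times> nat) \<Rightarrow> bool" where
  "is_code n R0 R1 R2 f1 f2 g1 g2 \<longleftrightarrow>
     (1 / real n) * (\<Sum>t<n. (\<Sum>m0\<in>{1..msize n R0}. \<Sum>m1\<in>{1..msize n R1}. (cmod (f1 m0 m1 t))\<^sup>2)
          / real (msize n R0 * msize n R1)) \<le> 1 \<and>
     (1 / real n) * (\<Sum>t<n. (\<Sum>m0\<in>{1..msize n R0}. \<Sum>m2\<in>{1..msize n R2}. (cmod (f2 m0 m2 t))\<^sup>2)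
          / real (msize n R0 * msize n R2)) \<le> 1 \<and>
     g1 \<in> measurable (outspace n) (count_space UNIV) \<and>
     g2 \<in> measurable (outspace n) (count_space UNIV)"

definition recv1 :: "complex \<Rightarrow> complex \<Rightarrow> nat \<Rightarrow> (nat \<Rightarrow> nat \<Rightarrow> nat \<Rightarrow> complex) \<Rightarrow>
    (nat \<Rightarrow> nat \<Rightarrow> nat \<Rightarrow> complex) \<Rightarrow> nat \<Rightarrow> nat \<Rightarrow> nat \<Rightarrow> (nat \<Rightarrow> complex \<times> complex) \<Rightarrow> nat \<Rightarrow> complex" where
  "recv1 h11 h12 n f1 f2 m0 m1 m2 z =
     restrict (\<lambda>t. h11 * f1 m0 m1 t + h12 * f2 m0 m2 t + fst (z t)) {..<n}"

definition recv2 :: "complex \<Rightarrow> complex \<Rightarrow> nat \<Rightarrow> (nat \<Rightarrow> nat \<Rightarrow> nat \<Rightarrow> complex) \<Rightarrow>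
    (nat \<Rightarrow> nat \<Rightarrow> nat \<Rightarrow> complex) \<Rightarrow> nat \<Rightarrow> nat \<Rightarrow> nat \<Rightarrow> (nat \<Rightarrow> complex \<times> complex) \<Rightarrow> nat \<Rightarrow> complex" where
  "recv2 h21 h22 n f1 f2 m0 m1 m2 z =
     restrict (\<lambda>t. h21 * f1 m0 m1 t + h22 * f2 m0 m2 t + snd (z t)) {..<n}"

definition err_prob ::
  "complex \<Rightarrow> complex \<Rightarrow> complex \<Rightarrow> complex \<Rightarrow> nat \<Rightarrow> real \<Rightarrow> real \<Rightarrow> real \<Rightarrow>
   (nat \<Rightarrow> nat \<Rightarrow> nat \<Rightarrow> complex) \<Rightarrow> (nat \<Rightarrow> nat \<Rightarrow> nat \<Rightarrow> complex) \<Rightarrow>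
   ((nat \<Rightarrow> complex) \<Rightarrow> nat \<times> nat) \<Rightarrow> ((nat \<Rightarrow> complex) \<Rightarrow> nat \<times> nat) \<Rightarrow> real" where
  "err_prob h11 h12 h21 h22 n R0 R1 R2 f1 f2 g1 g2 =
     (\<Sum>m0\<in>{1..msize n R0}. \<Sum>m1\<in>{1..msize n R1}. \<Sum>m2\<in>{1..msize n R2}.
        measure (noise n) {z \<in> space (noise n).
           g1 (recv1 h11 h12 n f1 f2 m0 m1 m2 z) \<noteq> (m0, m1) \<or>
           g2 (recv2 h21 h22 n f1 f2 m0 m1 m2 z) \<noteq> (m0, m2)})
     / real (msize n R0 * msize n R1 * msize n R2)"

definition achievable :: "complex \<Rightarrow> complex \<Rightarrow> complex \<Rightarrow> complex \<Rightarrow> real \<times> real \<times> real \<Rightarrow> bool" where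
  "achievable h11 h12 h21 h22 R \<longleftrightarrow>
     (case R of (R0, R1, R2) \<Rightarrow> R0 \<ge> 0 \<and> R1 \<ge> 0 \<and> R2 \<ge> 0 \<and>
       (\<exists>f1 f2 g1 g2. (\<forall>n. is_code n R0 R1 R2 (f1 n) (f2 n) (g1 n) (g2 n)) \<and>
          (\<lambda>n. err_prob h11 h12 h21 h22 n R0 R1 R2 (f1 n) (f2 n) (g1 n) (g2 n)) \<longlonglongrightarrow> 0))"

definition capacity_region :: "complex \<Rightarrow> complex \<Rightarrow> complex \<Rightarrow> complex \<Rightarrow> (real \<times> real \<times> real) set" where
  "capacity_region h11 h12 h21 h22 = closure {R. achievable h11 h12 h21 h22 R}"

definition outer_region :: "complex \<Rightarrow> complex \<Rightarrow> complex \<Rightarrow> complex \<Rightarrow> (real \<times> real \<times> real) set" where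
  "outer_region h11 h12 h21 h22 =
    (let a11 = (cmod h11)\<^sup>2; a12 = (cmod h12)\<^sup>2; a21 = (cmod h21)\<^sup>2; a22 = (cmod h22)\<^sup>2;
         A1 = Cap (a11 / (1 + a21)); A2 = Cap (a22 / (1 + a12));
         D1 = Cap a11; D2 = Cap a22;
         E1 = Cap (a12 + a11 / (1 + a21)); E2 = Cap (a21 + a22 / (1 + a12));
         G1 = Cap (a11 + a12); G2 = Cap (a22 + a21);
         G1' = Cap ((cmod h11 + cmod h12)\<^sup>2); G2' = Cap ((cmod h22 + cmod h21)\<^sup>2)
     in {(R0, R1, R2). R0 \<ge> 0 \<and> R1 \<ge> 0 \<and> R2 \<ge> 0 \<and>
          R0 + R1 \<le> G1' \<and> R0 + R2 \<le> G2' \<and> R1 \<le> D1 \<and> R2 \<le> D2 \<and>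
          R1 + R2 \<le> E1 + E2 \<and> R1 + R2 \<le> A1 + G2 \<and> R1 + R2 \<le> A2 + G1 \<and>
          R0 + R1 + R2 \<le> A1 + G2' \<and> R0 + R1 + R2 \<le> A2 + G1' \<and>
          2 * R1 + R2 \<le> A1 + G1 + E2 \<and> R1 + 2 * R2 \<le> A2 + G2 + E1 \<and>
          R0 + 2 * R1 + R2 \<le> A1 + G1' + E2 \<and> R0 + R1 + 2 * R2 \<le> A2 + G2' + E1})"

end

theory Submission
  imports Defs
begin

text \<open>
  Every bound is an instance of Gibbs' inequality \<open>E (ln f) \<le> 0\<close> for a likelihood ratio \<open>f\<close> with
  \<open>E f \<le> 1\<close>. Receiver 1 is given the side information \<open>S\<^sub>1 = g X\<^sub>1 + Z\<^sub>2\<close>, which is the interference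
  it causes for \<open>g = h\<^sub>2\<^sub>1\<close> and useless for \<open>g = 0\<close>. The true law of the messages, \<open>Y\<^sub>1\<close> and \<open>S\<^sub>1\<close>
  is compared with a law in which \<open>S\<^sub>1\<close> keeps its distribution given the common message,
  \<open>Y\<^sub>1\<close> given \<open>S\<^sub>1\<close> is Gaussian around the linear estimate with the variance that appears in the
  outer bound, and the message is drawn from a mixture of the decoder output and the uniform
  distribution (this replaces Fano's inequality). The result bounds a rate by a capacity term plus
  the conditional entropy of \<open>S\<^sub>1\<close> minus that of the interference \<open>S\<^sub>2 = h\<^sub>1\<^sub>2 X\<^sub>2 + Z\<^sub>1\<close>.
  Revealing the other private message as well replaces the entropy of \<open>S\<^sub>2\<close> by that of pure noise.
  In each sum of rates in the outer region the entropies of \<open>S\<^sub>1\<close> and \<open>S\<^sub>2\<close> cancel.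
\<close>

subsection \<open>Complex Gaussian noise\<close>

text \<open>Density of the circularly symmetric complex Gaussian of variance
  \<open>\<sigma>\<close>. The normalising factor carries no square root because the plane has real
  dimension two.\<close>

definition qdens :: "real \<Rightarrow> complex \<Rightarrow> real" where
  "qdens \<sigma> z = exp (- ((cmod z)\<^sup>2 / \<sigma>)) / (pi * \<sigma>)"

lemma qdens_pos: "\<sigma> > 0 \<Longrightarrow> qdens \<sigma> z > 0"
  by (simp add: qdens_def)

lemma qdens_measurable [measurable]: "qdens \<sigma> \<in> borel_measurable borel"
  unfolding qdens_def[abs_def] by measurable

definition gdens :: "complex \<Rightarrow> real" where
  "gdens z = exp (- (cmod z)\<^sup>2) / pi"

lemma gdens_pos: "gdens z > 0"
  by (simp add: gdens_def)

lemma gdens_measurable [measurable]: "gdens \<in> borel_measurable borel"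
  unfolding gdens_def[abs_def] by measurable

section \<open>Planar Lebesgue measure and Gaussian moments\<close>

lemma Complex_measurable [measurable]:
  "(\<lambda>(x, y). Complex x y) \<in> measurable (lborel \<Otimes>\<^sub>M lborel) borel"
  unfolding lborel_prod case_prod_beta' Complex_eq
  by (simp, intro borel_measurable_continuous_onI continuous_intros)

text \<open>Lebesgue measure is determined by its values on boxes, and a complex box is a product of
  two real intervals. This reduces planar Gaussian integrals to iterated real ones.\<close>

lemma lborel_complex:
  "(lborel :: complex measure) = distr (lborel \<Otimes>\<^sub>M lborel) borel (\<lambda>(x, y). Complex x y)"
proof (rule lborel_eqI)
  fix l u :: complex
  assume le: "\<And>b. b \<in> Basis \<Longrightarrow> l \<bullet> b \<le> u \<bullet> b"
  have "(\<lambda>(x, y). Complex x y) -` box l u \<inter> space (lborel \<Otimes>\<^sub>M lborel)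
      = {Re l <..< Re u} \<times> {Im l <..< Im u}"
    by (auto simp: in_box_complex_iff space_pair_measure)
  then have "emeasure (distr (lborel \<Otimes>\<^sub>M lborel) borel (\<lambda>(x, y). Complex x y)) (box l u)
      = emeasure (lborel \<Otimes>\<^sub>M lborel) ({Re l <..< Re u} \<times> {Im l <..< Im u})"
    by (subst emeasure_distr[OF Complex_measurable]) auto
  also have "\<dots> = ennreal (Re u - Re l) * ennreal (Im u - Im l)"
    using le[of 1] le[of \<i>] by (subst lborel.emeasure_pair_measure_Times) (auto simp: Basis_complex_def)
  also have "\<dots> = (\<Prod>b\<in>Basis. (u - l) \<bullet> b)"
    using le[of 1] le[of \<i>] by (simp add: Basis_complex_def ennreal_mult'')
  finally show "emeasure (distr (lborel \<Otimes>\<^sub>M lborel) borel (\<lambda>(x, y). Complex x y)) (box l u)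
      = (\<Prod>b\<in>Basis. (u - l) \<bullet> b)" .
qed simp

lemma nn_integral_lborel_complex:
  assumes [measurable]: "f \<in> borel_measurable borel"
  shows "(\<integral>\<^sup>+z. f z \<partial>lborel) = (\<integral>\<^sup>+y. \<integral>\<^sup>+x. f (Complex x y) \<partial>lborel \<partial>lborel)"
proof -
  have "(\<integral>\<^sup>+z. f z \<partial>lborel) = (\<integral>\<^sup>+p. f (Complex (fst p) (snd p)) \<partial>(lborel \<Otimes>\<^sub>M lborel))"
    by (subst lborel_complex, subst nn_integral_distr) (auto simp: case_prod_beta')
  also have "\<dots> = (\<integral>\<^sup>+y. \<integral>\<^sup>+x. f (Complex x y) \<partial>lborel \<partial>lborel)"
    using Complex_measurable
    by (subst lborel_pair.nn_integral_snd[symmetric])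
      (auto simp: case_prod_beta' intro!: measurable_compose[OF _ assms])
  finally show ?thesis .
qed

text \<open>Each real coordinate has variance 1/2, so that the complex variable has variance
  1.\<close>

definition rgd :: "real \<Rightarrow> real" where "rgd = normal_density 0 (1 / sqrt 2)"

lemma gdens_Complex: "gdens (Complex x y) = rgd x * rgd y"
  by (simp add: gdens_def rgd_def normal_density_def cmod_power2 field_simps flip: exp_add)

lemma rgd_pos: "rgd x > 0"
  by (simp add: rgd_def normal_density_pos)

lemma rgd_measurable [measurable]: "rgd \<in> borel_measurable borel"
  by (simp add: rgd_def)

lemma nn_integral_rgd: "(\<integral>\<^sup>+x. ennreal (rgd x) \<partial>lborel) = 1"
  by (subst nn_integral_eq_integral) (simp_all add: rgd_def)

lemma nn_integral_rgd_square:
  "(\<integral>\<^sup>+x. ennreal (rgd x * (c + d * x)\<^sup>2) \<partial>lborel) = ennreal (c\<^sup>2 + d\<^sup>2 / 2)"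
proof -
  have 0: "has_bochner_integral lborel rgd 1"
    unfolding rgd_def by (simp add: has_bochner_integral_iff)
  have 1: "has_bochner_integral lborel (\<lambda>x. rgd x * x) 0"
    unfolding rgd_def using normal_moment_nz_1[of "1 / sqrt 2" 0] by simp
  have 2: "has_bochner_integral lborel (\<lambda>x. rgd x * x\<^sup>2) (1 / 2)"
    unfolding rgd_def using normal_moment_even[of "1 / sqrt 2" 0 1] by (simp add: power_divide fact_numeral)
  have "has_bochner_integral lborel (\<lambda>x. c\<^sup>2 * rgd x + (2 * c * d) * (rgd x * x) + d\<^sup>2 * (rgd x * x\<^sup>2))
      (c\<^sup>2 * 1 + (2 * c * d) * 0 + d\<^sup>2 * (1 / 2))"
    by (intro has_bochner_integral_add has_bochner_integral_mult_right 0 1 2)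
  then have *: "has_bochner_integral lborel (\<lambda>x. rgd x * (c + d * x)\<^sup>2) (c\<^sup>2 + d\<^sup>2 / 2)"
    by (simp add: power2_eq_square algebra_simps)
  show ?thesis
    using * by (subst nn_integral_eq_integral) (auto simp: has_bochner_integral_iff rgd_pos less_imp_le)
qed

lemma Complex_measurable_section [measurable]:
  "(\<lambda>x. Complex x y) \<in> borel_measurable borel" "Complex x \<in> borel_measurable borel"
  by (simp_all add: Complex_eq[abs_def])

lemma nn_integral_gdens: "(\<integral>\<^sup>+z. ennreal (gdens z) \<partial>lborel) = 1"
  by (simp add: nn_integral_lborel_complex gdens_Complex ennreal_mult' rgd_pos less_imp_le
      nn_integral_cmult nn_integral_multc nn_integral_rgd)

lemma nn_integral_gdens_square:
  "(\<integral>\<^sup>+z. ennreal (gdens z * (cmod (d + k * z))\<^sup>2) \<partial>lborel) = ennreal ((cmod d)\<^sup>2 + (cmod k)\<^sup>2)"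
proof -
  \<comment> \<open>For fixed \<open>y\<close> the real and imaginary parts of
    \<open>d + k * z\<close> are affine in \<open>x\<close>, with slopes \<open>Re k\<close> and
    \<open>Im k\<close>. Integrating over \<open>x\<close> yields half of |k|^2; the slopes in
    \<open>y\<close> yield the other half afterwards.\<close>
  have inner: "(\<integral>\<^sup>+x. ennreal (gdens (Complex x y) * (cmod (d + k * Complex x y))\<^sup>2) \<partial>lborel)
      = ennreal (rgd y * (Re d + (- Im k) * y)\<^sup>2) + ennreal (rgd y * (Im d + Re k * y)\<^sup>2)
        + ennreal (rgd y) * ennreal ((cmod k)\<^sup>2 / 2)" (is "?l = ?r") for y
  proof -
    have "?l = (\<integral>\<^sup>+x. ennreal (rgd y) * (ennreal (rgd x * ((Re d - Im k * y) + Re k * x)\<^sup>2)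
        + ennreal (rgd x * ((Im d + Re k * y) + Im k * x)\<^sup>2)) \<partial>lborel)"
      by (intro nn_integral_cong)
        (simp add: gdens_Complex cmod_power2 rgd_pos less_imp_le algebra_simps
          flip: ennreal_plus ennreal_mult'')
    also have "\<dots> = ennreal (rgd y) * (ennreal ((Re d - Im k * y)\<^sup>2 + (Re k)\<^sup>2 / 2)
        + ennreal ((Im d + Re k * y)\<^sup>2 + (Im k)\<^sup>2 / 2))"
      by (simp add: nn_integral_cmult nn_integral_add nn_integral_rgd_square)
    also have "\<dots> = ?r"
      by (simp add: cmod_power2 rgd_pos less_imp_le algebra_simps add_divide_distrib
          flip: ennreal_plus ennreal_mult'')
    finally show ?thesis .
  qed
  have "(\<integral>\<^sup>+z. ennreal (gdens z * (cmod (d + k * z))\<^sup>2) \<partial>lborel)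
     = ennreal ((Re d)\<^sup>2 + (- Im k)\<^sup>2 / 2) + ennreal ((Im d)\<^sup>2 + (Re k)\<^sup>2 / 2) + ennreal ((cmod k)\<^sup>2 / 2)"
    by (subst nn_integral_lborel_complex, measurable)
      (simp only: inner, simp add: nn_integral_add nn_integral_multc nn_integral_rgd_square nn_integral_rgd
        nn_integral_rgd_square[of "Re d" "- Im k", simplified])
  also have "\<dots> = ennreal ((cmod d)\<^sup>2 + (cmod k)\<^sup>2)"
    by (simp add: cmod_power2 field_simps flip: ennreal_plus)
  finally show ?thesis .
qed

lemma cgauss_eq: "cgauss = density lborel (\<lambda>z. ennreal (gdens z))"
  by (simp add: cgauss_def gdens_def)

lemma sets_cgauss [measurable_cong, simp]: "sets cgauss = sets borel"
  by (simp add: cgauss_eq)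

lemma space_cgauss [simp]: "space cgauss = UNIV"
  by (simp add: cgauss_eq)

lemma prob_space_cgauss: "prob_space cgauss"
  by (rule prob_spaceI) (simp add: cgauss_eq emeasure_density nn_integral_gdens)

interpretation cgauss: prob_space cgauss by (rule prob_space_cgauss)
interpretation cgauss_pair: pair_prob_space cgauss cgauss ..

lemma nn_integral_cgauss_square:
  "(\<integral>\<^sup>+z. ennreal ((cmod (d + k * z))\<^sup>2) \<partial>cgauss) = ennreal ((cmod d)\<^sup>2 + (cmod k)\<^sup>2)"
  by (simp add: cgauss_eq nn_integral_density gdens_pos less_imp_le nn_integral_gdens_square
      flip: ennreal_mult'')

lemma cgauss_pair_square:
  "has_bochner_integral (cgauss \<Otimes>\<^sub>M cgauss) (\<lambda>z. (cmod (d + j * fst z + k * snd z))\<^sup>2)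
     ((cmod d)\<^sup>2 + (cmod j)\<^sup>2 + (cmod k)\<^sup>2)"
proof (rule has_bochner_integral_nn_integral)
  have "(\<integral>\<^sup>+z. ennreal ((cmod (d + j * fst z + k * snd z))\<^sup>2) \<partial>(cgauss \<Otimes>\<^sub>M cgauss))
      = (\<integral>\<^sup>+x. \<integral>\<^sup>+y. ennreal ((cmod ((d + j * x) + k * y))\<^sup>2) \<partial>cgauss \<partial>cgauss)"
    by (subst cgauss.nn_integral_fst[symmetric]) auto
  also have "\<dots> = (\<integral>\<^sup>+x. ennreal ((cmod (d + j * x))\<^sup>2) + ennreal ((cmod k)\<^sup>2) \<partial>cgauss)"
    by (simp only: nn_integral_cgauss_square) (simp add: ennreal_plus)
  also have "\<dots> = ennreal ((cmod d)\<^sup>2 + (cmod j)\<^sup>2) + ennreal ((cmod k)\<^sup>2)"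
    by (subst nn_integral_add) (auto simp: nn_integral_cgauss_square cgauss.emeasure_space_1[simplified])
  finally show "(\<integral>\<^sup>+z. ennreal ((cmod (d + j * fst z + k * snd z))\<^sup>2) \<partial>(cgauss \<Otimes>\<^sub>M cgauss))
      = ennreal ((cmod d)\<^sup>2 + (cmod j)\<^sup>2 + (cmod k)\<^sup>2)" by (simp flip: ennreal_plus)
qed auto

lemma nn_integral_gdens_scaled:
  assumes "\<sigma> > 0"
  shows "(\<integral>\<^sup>+z. ennreal (qdens \<sigma> (z - m)) \<partial>lborel) = 1"
proof -
  \<comment> \<open>The substitution by m + sqrt \<sigma> z has Jacobian \<sigma>, the square of
    sqrt \<sigma>, in real dimension two.\<close>
  have "(\<integral>\<^sup>+z. ennreal (qdens \<sigma> (z - m)) \<partial>lborel)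
     = (\<integral>\<^sup>+z. ennreal \<sigma> * ennreal (qdens \<sigma> (sqrt \<sigma> *\<^sub>R z)) \<partial>lborel)"
    using assms by (subst lborel_affine[of "sqrt \<sigma>" m])
      (simp_all add: nn_integral_density nn_integral_distr)
  also have "\<dots> = (\<integral>\<^sup>+z. ennreal (gdens z) \<partial>lborel)"
    using assms by (intro nn_integral_cong)
      (simp add: gdens_def qdens_def power_mult_distrib norm_mult flip: ennreal_mult'')
  finally show ?thesis by (simp add: nn_integral_gdens)
qed

lemma nn_integral_gdens_shift: "(\<integral>\<^sup>+z. ennreal (gdens (z - m)) \<partial>lborel) = 1"
  using nn_integral_gdens_scaled[of 1 m] by (simp add: gdens_def qdens_def)

text \<open>Chain rule for a joint density: the second coordinate is Gaussian around
  \<open>v\<close>, and given it the first is Gaussian around an affine function of it. Integrating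
  out the first coordinate leaves the marginal of the second.\<close>

lemma nn_integral_conditional_gauss:
  assumes "\<sigma> > 0"
  shows "(\<integral>\<^sup>+z. ennreal (qdens \<sigma> (fst z - m - k * snd z) * gdens (snd z - v)) \<partial>lborel) = 1"
proof -
  have "(\<integral>\<^sup>+z. ennreal (qdens \<sigma> (fst z - m - k * snd z) * gdens (snd z - v)) \<partial>lborel)
     = (\<integral>\<^sup>+s. \<integral>\<^sup>+y. ennreal (qdens \<sigma> (y - (m + k * s))) * ennreal (gdens (s - v)) \<partial>lborel \<partial>lborel)"
    using assms by (subst lborel_prod[symmetric], subst lborel_pair.nn_integral_snd[symmetric])
      (auto simp: algebra_simps gdens_pos qdens_pos less_imp_le simp flip: ennreal_mult'')
  also have "\<dots> = 1"
    using assms by (simp add: nn_integral_multc nn_integral_gdens_scaled nn_integral_gdens_shift)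
  finally show ?thesis .
qed

section \<open>Finite product measures: densities and coordinatewise maps\<close>

lemma (in product_sigma_finite) density_PiM:
  assumes I: "finite I" and f: "\<And>i. i \<in> I \<Longrightarrow> f i \<in> borel_measurable (M i)"
    and sf: "product_sigma_finite (\<lambda>i. density (M i) (f i))"
  shows "PiM I (\<lambda>i. density (M i) (f i)) = density (PiM I M) (\<lambda>x. \<Prod>i\<in>I. f i (x i))"
proof (rule product_sigma_finite.PiM_eqI[OF sf I, symmetric])
  note f[measurable]
  have [measurable]: "(\<lambda>x. \<Prod>i\<in>I. f i (x i)) \<in> borel_measurable (PiM I M)"
    by (rule borel_measurable_prod_ennreal) measurable
  show "sets (density (PiM I M) (\<lambda>x. \<Prod>i\<in>I. f i (x i))) = sets (PiM I (\<lambda>i. density (M i) (f i)))"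
    by (simp cong: sets_PiM_cong)
  fix A assume A: "\<And>i. i \<in> I \<Longrightarrow> A i \<in> sets (density (M i) (f i))"
  then have A'[measurable]: "i \<in> I \<Longrightarrow> A i \<in> sets (M i)" for i by simp
  have [measurable]: "Pi\<^sub>E I A \<in> sets (PiM I M)"
    using A' I by (intro sets_PiM_I_finite) auto
  have "emeasure (density (PiM I M) (\<lambda>x. \<Prod>i\<in>I. f i (x i))) (Pi\<^sub>E I A)
     = (\<integral>\<^sup>+x. (\<Prod>i\<in>I. f i (x i)) * indicator (Pi\<^sub>E I A) x \<partial>PiM I M)"
    by (simp add: emeasure_density)
  also have "\<dots> = (\<integral>\<^sup>+x. (\<Prod>i\<in>I. f i (x i) * indicator (A i) (x i)) \<partial>PiM I M)"
  proof (rule nn_integral_cong)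
    fix x assume x: "x \<in> space (PiM I M)"
    then have "indicator (Pi\<^sub>E I A) x = (\<Prod>i\<in>I. indicator (A i) (x i) :: ennreal)"
      using I by (auto simp: indicator_def PiE_def space_PiM Pi_iff split: if_splits)
    then show "(\<Prod>i\<in>I. f i (x i)) * indicator (Pi\<^sub>E I A) x = (\<Prod>i\<in>I. f i (x i) * indicator (A i) (x i))"
      by (simp add: prod.distrib)
  qed
  also have "\<dots> = (\<Prod>i\<in>I. \<integral>\<^sup>+x. f i x * indicator (A i) x \<partial>M i)"
    by (rule product_nn_integral_prod[OF I]) measurable
  also have "\<dots> = (\<Prod>i\<in>I. emeasure (density (M i) (f i)) (A i))"
    by (intro prod.cong refl) (simp add: emeasure_density)
  finally show "emeasure (density (PiM I M) (\<lambda>x. \<Prod>i\<in>I. f i (x i))) (Pi\<^sub>E I A)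
     = (\<Prod>i\<in>I. emeasure (density (M i) (f i)) (A i))" .
qed

text \<open>Product boxes determine the measure, and the preimage of a box is again a box. This
  serves both the translations of Lebesgue measure and the exchange of the two noises at every
  time.\<close>

lemma (in product_sigma_finite) distr_PiM_componentwise:
  assumes I: "finite I" and T: "\<And>i. i \<in> I \<Longrightarrow> T i \<in> measurable (M i) (M i)"
    and inv: "\<And>i. i \<in> I \<Longrightarrow> distr (M i) (M i) (T i) = M i"
  shows "distr (PiM I M) (PiM I M) (\<lambda>x. \<lambda>i\<in>I. T i (x i)) = PiM I M"
proof (rule PiM_eqI[OF I])
  note T[measurable]
  have m[measurable]: "(\<lambda>x. \<lambda>i\<in>I. T i (x i)) \<in> measurable (PiM I M) (PiM I M)"
    by (rule measurable_restrict) measurable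
  fix A assume A: "\<And>i. i \<in> I \<Longrightarrow> A i \<in> sets (M i)"
  then have "(\<lambda>x. \<lambda>i\<in>I. T i (x i)) -` Pi\<^sub>E I A \<inter> space (PiM I M)
      = Pi\<^sub>E I (\<lambda>i. T i -` A i \<inter> space (M i))"
    by (auto simp: space_PiM PiE_iff)
  then have "emeasure (distr (PiM I M) (PiM I M) (\<lambda>x. \<lambda>i\<in>I. T i (x i))) (Pi\<^sub>E I A)
     = (\<Prod>i\<in>I. emeasure (M i) (T i -` A i \<inter> space (M i)))"
    using A T I by (subst emeasure_distr[OF m]) (auto simp: emeasure_PiM measurable_sets intro!: sets_PiM_I_finite)
  also have "\<dots> = (\<Prod>i\<in>I. emeasure (M i) (A i))"
    using A T by (intro prod.cong refl) (metis emeasure_distr inv)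
  finally show "emeasure (distr (PiM I M) (PiM I M) (\<lambda>x. \<lambda>i\<in>I. T i (x i))) (Pi\<^sub>E I A)
     = (\<Prod>i\<in>I. emeasure (M i) (A i))" .
qed simp

section \<open>The noise of a block of n channel uses\<close>

definition Phi :: "nat \<Rightarrow> (nat \<Rightarrow> complex) \<Rightarrow> real" where
  "Phi n x = (\<Prod>t<n. gdens (x t))"

definition leb :: "nat \<Rightarrow> (nat \<Rightarrow> complex \<times> complex) measure" where
  "leb n = PiM {..<n} (\<lambda>_. lborel)"

text \<open>A coordinate pair holds an output and a side information symbol; adding the noiseless
  signals \<open>a\<close> and \<open>b\<close> turns noise into the observed pair. The restriction
  to times below \<open>n\<close> keeps the result in the space of the product measure.\<close>

definition offset :: "nat \<Rightarrow> (nat \<Rightarrow> complex) \<Rightarrow> (nat \<Rightarrow> complex) \<Rightarrow>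
    (nat \<Rightarrow> complex \<times> complex) \<Rightarrow> nat \<Rightarrow> complex \<times> complex" where
  "offset n a b z = (\<lambda>t\<in>{..<n}. (a t, b t) + z t)"

interpretation LB: product_sigma_finite "\<lambda>_::nat. lborel :: (complex \<times> complex) measure"
  by standard

interpretation NP: product_sigma_finite "\<lambda>_::nat. cgauss \<Otimes>\<^sub>M cgauss"
  by standard

lemma Phi_pos: "Phi n x > 0"
  by (simp add: Phi_def gdens_pos prod_pos)

lemma sets_leb [measurable_cong]: "sets (leb n) = sets (PiM {..<n} (\<lambda>_. borel))"
  unfolding leb_def by (intro sets_PiM_cong) auto

lemma sets_noise [measurable_cong]: "sets (noise n) = sets (leb n)"
  unfolding leb_def noise_def
  by (intro sets_PiM_cong refl) (simp add: borel_prod[symmetric] cong: sets_pair_measure_cong)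

lemma prob_space_noise: "prob_space (noise n)"
  unfolding noise_def by (rule prob_space_PiM) (rule cgauss_pair.prob_space_axioms)

lemma borel_fst_snd [measurable]:
  "fst \<in> borel_measurable (borel :: ('a::second_countable_topology \<times> 'b::second_countable_topology) measure)"
  "snd \<in> borel_measurable (borel :: ('a::second_countable_topology \<times> 'b::second_countable_topology) measure)"
  by (simp_all add: borel_prod[symmetric])

lemma cgauss_pair_density:
  "cgauss \<Otimes>\<^sub>M cgauss = density lborel (\<lambda>z. ennreal (gdens (fst z) * gdens (snd z)))"
  unfolding cgauss_eq
  by (subst pair_measure_density)
    (auto simp: lborel_prod case_prod_beta' gdens_pos less_imp_le ennreal_mult''
      cgauss.sigma_finite_measure_axioms[unfolded cgauss_eq] lborel.sigma_finite_measure_axioms)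

lemma noise_density:
  "noise n = density (leb n) (\<lambda>z. ennreal (Phi n (\<lambda>t. fst (z t)) * Phi n (\<lambda>t. snd (z t))))"
  unfolding noise_def leb_def cgauss_pair_density
  by (subst LB.density_PiM)
    (auto simp: Phi_def prod_ennreal gdens_pos less_imp_le prod.distrib
      NP.product_sigma_finite_axioms[unfolded cgauss_pair_density])

lemma coordinate_measurable [measurable]:
  "t < n \<Longrightarrow> (\<lambda>z. fst (z t)) \<in> borel_measurable (leb n)"
  "t < n \<Longrightarrow> (\<lambda>z. snd (z t)) \<in> borel_measurable (leb n)"
  unfolding leb_def by (auto intro!: measurable_compose[OF _ borel_fst_snd(1)] measurable_compose[OF _ borel_fst_snd(2)])

lemma Phi_measurable [measurable]:
  assumes "\<And>t. t < n \<Longrightarrow> (\<lambda>z. f z t) \<in> borel_measurable M"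
  shows "(\<lambda>z. Phi n (f z)) \<in> borel_measurable M"
  using assms unfolding Phi_def by (intro borel_measurable_prod measurable_compose[OF _ gdens_measurable]) auto

lemma offset_measurable [measurable]: "offset n a b \<in> measurable (leb n) (leb n)"
  unfolding offset_def[abs_def] leb_def by (rule measurable_restrict) measurable

lemma nn_integral_leb_offset:
  assumes [measurable]: "f \<in> borel_measurable (leb n)"
  shows "(\<integral>\<^sup>+z. f (offset n a b z) \<partial>leb n) = (\<integral>\<^sup>+z. f z \<partial>leb n)"
proof -
  have "distr (leb n) (leb n) (offset n a b) = leb n"
    unfolding leb_def offset_def[abs_def]
    by (rule LB.distr_PiM_componentwise)
      (auto simp: lborel_distr_plus cong: distr_cong)
  then have "(\<integral>\<^sup>+z. f z \<partial>leb n) = (\<integral>\<^sup>+z. f z \<partial>distr (leb n) (leb n) (offset n a b))" by simp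
  also have "\<dots> = (\<integral>\<^sup>+z. f (offset n a b z) \<partial>leb n)"
    by (rule nn_integral_distr) measurable
  finally show ?thesis by simp
qed

text \<open>The two noises are independent with the same law, hence exchangeable. This carries
  statements about the first noise over to the second, and one receiver's analysis over to the
  other.\<close>

lemma distr_noise_swap:
  "distr (noise n) (noise n) (\<lambda>z. \<lambda>t\<in>{..<n}. prod.swap (z t)) = noise n"
  unfolding noise_def
proof (rule NP.distr_PiM_componentwise)
  show "distr (cgauss \<Otimes>\<^sub>M cgauss) (cgauss \<Otimes>\<^sub>M cgauss) prod.swap = cgauss \<Otimes>\<^sub>M cgauss"
    using cgauss_pair.distr_pair_swap by (simp add: prod.swap_def[abs_def] case_prod_beta')
qed (auto simp: prod.swap_def[abs_def])

lemma noise_coordinate_integral: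
  fixes f :: "complex \<times> complex \<Rightarrow> real"
  assumes t: "t < n" and f: "has_bochner_integral (cgauss \<Otimes>\<^sub>M cgauss) f r"
  shows "has_bochner_integral (noise n) (\<lambda>z. f (z t)) r"
proof -
  have d: "distr (noise n) (cgauss \<Otimes>\<^sub>M cgauss) (\<lambda>z. z t) = cgauss \<Otimes>\<^sub>M cgauss"
    unfolding noise_def using t
    by (intro distr_PiM_component[of "{..<n}" "\<lambda>_. cgauss \<Otimes>\<^sub>M cgauss"] cgauss_pair.prob_space_axioms) auto
  have [measurable]: "(\<lambda>z. z t) \<in> measurable (noise n) (cgauss \<Otimes>\<^sub>M cgauss)"
    unfolding noise_def using t by (intro measurable_component_singleton) auto
  have "has_bochner_integral (distr (noise n) (cgauss \<Otimes>\<^sub>M cgauss) (\<lambda>z. z t)) f r"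
    unfolding d by (rule f)
  then show ?thesis
    using f by (simp add: has_bochner_integral_iff integrable_distr_eq integral_distr)
qed

lemma noise_square:
  assumes "t < n"
  shows "has_bochner_integral (noise n) (\<lambda>z. (cmod (d + j * fst (z t) + k * snd (z t)))\<^sup>2)
     ((cmod d)\<^sup>2 + (cmod j)\<^sup>2 + (cmod k)\<^sup>2)"
  by (rule noise_coordinate_integral[OF assms cgauss_pair_square])

subsection \<open>Gaussian mixtures and their entropies\<close>

text \<open>Gibbs' inequality from ln x \<le> x - 1, summed over a finite message set without
  normalising: the bound \<open>card S\<close> says that the average expectation is at most 1. It
  also forces each \<open>f m\<close> to be integrable.\<close>

lemma (in prob_space) integral_ln_le_0:
  assumes S: "finite S" "S \<noteq> {}"
    and f[measurable]: "\<And>m. m \<in> S \<Longrightarrow> f m \<in> borel_measurable M"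
    and pos: "\<And>m z. m \<in> S \<Longrightarrow> z \<in> space M \<Longrightarrow> f m z > 0"
    and int: "\<And>m. m \<in> S \<Longrightarrow> integrable M (\<lambda>z. ln (f m z))"
    and le: "(\<Sum>m\<in>S. \<integral>\<^sup>+z. ennreal (f m z) \<partial>M) \<le> ennreal (card S)"
  shows "(\<Sum>m\<in>S. \<integral>z. ln (f m z) \<partial>M) \<le> 0"
proof -
  have fint: "integrable M (f m)" if m: "m \<in> S" for m
  proof (rule integrableI_nonneg)
    show "AE z in M. 0 \<le> f m z" using pos[OF m] by (auto intro!: AE_I2 less_imp_le)
    have "(\<integral>\<^sup>+z. ennreal (f m z) \<partial>M) \<le> (\<Sum>m\<in>S. \<integral>\<^sup>+z. ennreal (f m z) \<partial>M)"
      using S m by (intro member_le_sum) auto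
    also have "\<dots> < \<infinity>" using le by (auto intro: le_less_trans)
    finally show "(\<integral>\<^sup>+z. ennreal (f m z) \<partial>M) < \<infinity>" .
  qed (use m in measurable)
  have nn: "0 \<le> (\<integral>z. f m z \<partial>M)" if m: "m \<in> S" for m
    using pos[OF m] by (intro Bochner_Integration.integral_nonneg less_imp_le) auto
  have "ennreal (\<Sum>m\<in>S. \<integral>z. f m z \<partial>M) = (\<Sum>m\<in>S. ennreal (\<integral>z. f m z \<partial>M))"
    using nn by (simp add: sum_ennreal)
  also have "\<dots> = (\<Sum>m\<in>S. \<integral>\<^sup>+z. ennreal (f m z) \<partial>M)"
    using pos fint by (intro sum.cong refl nn_integral_eq_integral[symmetric]) (auto intro!: AE_I2 less_imp_le)
  finally have "ennreal (\<Sum>m\<in>S. \<integral>z. f m z \<partial>M) \<le> ennreal (card S)" using le by simp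
  then have sle: "(\<Sum>m\<in>S. \<integral>z. f m z \<partial>M) \<le> card S" by simp
  have "(\<Sum>m\<in>S. \<integral>z. ln (f m z) \<partial>M) \<le> (\<Sum>m\<in>S. (\<integral>z. f m z - 1 \<partial>M))"
    using pos fint int by (intro sum_mono integral_mono) (auto intro!: ln_le_minus_one)
  also have "\<dots> = (\<Sum>m\<in>S. (\<integral>z. f m z \<partial>M)) - card S"
    using fint by (simp add: prob_space sum_subtractf)
  finally show ?thesis using sle by simp
qed

definition mix :: "nat \<Rightarrow> 'a set \<Rightarrow> ('a \<Rightarrow> nat \<Rightarrow> complex) \<Rightarrow> (nat \<Rightarrow> complex) \<Rightarrow> real" where
  "mix n A v x = (\<Sum>a\<in>A. Phi n (\<lambda>t. x t - v a t)) / card A"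

text \<open>\<open>hmix n C A v\<close> is the differential entropy (in nats) of \<open>v c a + Z\<close> given \<open>c\<close>, for
  \<open>c\<close> and \<open>a\<close> uniform on \<open>C\<close> and \<open>A\<close>, as \<open>mix n A (v c)\<close> is its conditional density.\<close>

definition hmix :: "nat \<Rightarrow> 'c set \<Rightarrow> 'a set \<Rightarrow> ('c \<Rightarrow> 'a \<Rightarrow> nat \<Rightarrow> complex) \<Rightarrow> real" where
  "hmix n C A v = - (\<Sum>c\<in>C. \<Sum>a\<in>A. \<integral>z. ln (mix n A (v c) (\<lambda>t. v c a t + fst (z t))) \<partial>noise n)
     / (card C * card A)"

lemma Phi_cong: "(\<And>t. t < n \<Longrightarrow> x t = y t) \<Longrightarrow> Phi n x = Phi n y"
  by (simp add: Phi_def)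

lemma mix_cong: "(\<And>t. t < n \<Longrightarrow> x t = y t) \<Longrightarrow> mix n A v x = mix n A v y"
  unfolding mix_def by (intro arg_cong2[where f="(/)"] sum.cong refl Phi_cong) simp

lemma ln_Phi: "ln (Phi n x) = - real n * ln pi - (\<Sum>t<n. (cmod (x t))\<^sup>2)"
  by (simp add: Phi_def ln_prod gdens_pos gdens_def ln_div sum_subtractf sum_negf)

lemma mix_pos: "finite A \<Longrightarrow> A \<noteq> {} \<Longrightarrow> mix n A v x > 0"
  unfolding mix_def by (intro divide_pos_pos sum_pos) (auto simp: Phi_pos card_gt_0_iff)

lemma mix_measurable [measurable]:
  assumes [measurable]: "\<And>t. t < n \<Longrightarrow> (\<lambda>z. f z t) \<in> borel_measurable M"
  shows "(\<lambda>z. mix n A v (f z)) \<in> borel_measurable M"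
  unfolding mix_def by measurable

lemma Phi_le_1: "Phi n x \<le> 1"
  unfolding Phi_def using pi_ge_two
  by (intro prod_le_1) (auto simp: gdens_def divide_le_eq less_imp_le intro: order_trans[of _ 1])

lemma mix_le_1: "finite A \<Longrightarrow> A \<noteq> {} \<Longrightarrow> mix n A v x \<le> 1"
  unfolding mix_def using sum_bounded_above[of A "\<lambda>a. Phi n (\<lambda>t. x t - v a t)" 1]
  by (auto simp: divide_le_eq_1 Phi_le_1 card_gt_0_iff)

text \<open>A mixture never exceeds 1, so its logarithm is nonpositive. From below, the mixture
  keeps at least the term of the codeword \<open>a\<close> that was sent, divided by
  \<open>card A\<close>. The logarithm thus grows at most quadratically in the noise, which makes it
  integrable.\<close>

lemma abs_ln_mix_le:
  assumes A: "finite A" "a \<in> A"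
  shows "\<bar>ln (mix n A v (\<lambda>t. v a t + x t))\<bar> \<le> ln (card A) + n * ln pi + (\<Sum>t<n. (cmod (x t))\<^sup>2)"
proof -
  have ne: "A \<noteq> {}" using A by auto
  have c: "0 < real (card A)" using A ne by (simp add: card_gt_0_iff)
  have "Phi n x \<le> (\<Sum>a'\<in>A. Phi n (\<lambda>t. v a t + x t - v a' t))"
    using member_le_sum[OF A(2), of "\<lambda>a'. Phi n (\<lambda>t. v a t + x t - v a' t)"] A
    by (simp add: Phi_pos less_imp_le)
  then have "Phi n x / card A \<le> mix n A v (\<lambda>t. v a t + x t)"
    unfolding mix_def using c by (intro divide_right_mono) auto
  then have "ln (Phi n x / card A) \<le> ln (mix n A v (\<lambda>t. v a t + x t))"
    using c by (intro ln_mono) (auto simp: Phi_pos)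
  then have "- ln (mix n A v (\<lambda>t. v a t + x t)) \<le> ln (card A) - ln (Phi n x)"
    using c Phi_pos[of n x] by (simp add: ln_div)
  moreover have "ln (mix n A v (\<lambda>t. v a t + x t)) \<le> 0"
    using mix_le_1[OF A(1) ne] mix_pos[OF A(1) ne] by (simp add: ln_le_zero_iff)
  ultimately show ?thesis by (simp add: ln_Phi)
qed

lemma noise_coordinate_square:
  assumes "t < n"
  shows "integrable (noise n) (\<lambda>z. (cmod (fst (z t)))\<^sup>2)" "(\<integral>z. (cmod (fst (z t)))\<^sup>2 \<partial>noise n) = 1"
    "integrable (noise n) (\<lambda>z. (cmod (snd (z t)))\<^sup>2)" "(\<integral>z. (cmod (snd (z t)))\<^sup>2 \<partial>noise n) = 1"
  using noise_square[OF assms, of 0 1 0] noise_square[OF assms, of 0 0 1]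
  by (simp_all add: has_bochner_integral_iff)

lemma noise_sum_square:
  "integrable (noise n) (\<lambda>z. \<Sum>t<n. (cmod (fst (z t)))\<^sup>2)"
  "(\<integral>z. (\<Sum>t<n. (cmod (fst (z t)))\<^sup>2) \<partial>noise n) = n"
  "integrable (noise n) (\<lambda>z. \<Sum>t<n. (cmod (snd (z t)))\<^sup>2)"
  "(\<integral>z. (\<Sum>t<n. (cmod (snd (z t)))\<^sup>2) \<partial>noise n) = n"
  by (auto simp: noise_coordinate_square Bochner_Integration.integral_sum
      intro!: Bochner_Integration.integrable_sum)

lemma integrable_ln_mix:
  assumes A: "finite A" "a \<in> A"
  shows "integrable (noise n) (\<lambda>z. ln (mix n A v (\<lambda>t. v a t + fst (z t))))"
    "integrable (noise n) (\<lambda>z. ln (mix n A v (\<lambda>t. v a t + snd (z t))))"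
proof -
  interpret prob_space "noise n" by (rule prob_space_noise)
  have 1: "integrable (noise n) (\<lambda>z. ln (card A) + n * ln pi + (\<Sum>t<n. (cmod (fst (z t)))\<^sup>2))"
    by (simp add: noise_sum_square)
  have 2: "integrable (noise n) (\<lambda>z. ln (card A) + n * ln pi + (\<Sum>t<n. (cmod (snd (z t)))\<^sup>2))"
    by (simp add: noise_sum_square)
  show "integrable (noise n) (\<lambda>z. ln (mix n A v (\<lambda>t. v a t + fst (z t))))"
    by (rule Bochner_Integration.integrable_bound[OF 1])
      (measurable, auto intro!: AE_I2 order_trans[OF abs_ln_mix_le[OF A]])
  show "integrable (noise n) (\<lambda>z. ln (mix n A v (\<lambda>t. v a t + snd (z t))))"
    by (rule Bochner_Integration.integrable_bound[OF 2])
      (measurable, auto intro!: AE_I2 order_trans[OF abs_ln_mix_le[OF A]])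
qed

lemma integral_noise_swap:
  fixes f :: "(nat \<Rightarrow> complex \<times> complex) \<Rightarrow> real"
  assumes [measurable]: "f \<in> borel_measurable (noise n)"
  shows "(\<integral>z. f (\<lambda>t\<in>{..<n}. prod.swap (z t)) \<partial>noise n) = (\<integral>z. f z \<partial>noise n)"
proof -
  have [measurable]: "(\<lambda>z. \<lambda>t\<in>{..<n}. prod.swap (z t)) \<in> measurable (noise n) (noise n)"
    unfolding noise_def by (rule measurable_restrict) (auto simp: prod.swap_def[abs_def])
  have "(\<integral>z. f z \<partial>noise n) = (\<integral>z. f z \<partial>distr (noise n) (noise n) (\<lambda>z. \<lambda>t\<in>{..<n}. prod.swap (z t)))"
    by (simp add: distr_noise_swap)
  also have "\<dots> = (\<integral>z. f (\<lambda>t\<in>{..<n}. prod.swap (z t)) \<partial>noise n)"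
    by (rule integral_distr) measurable
  finally show ?thesis by simp
qed

text \<open>Side information is disturbed by the second noise, whereas \<open>hmix\<close> is
  defined with the first; exchangeability reconciles the two.\<close>

lemma integral_ln_mix_snd:
  "(\<integral>z. ln (mix n A v (\<lambda>t. a t + snd (z t))) \<partial>noise n)
     = (\<integral>z. ln (mix n A v (\<lambda>t. a t + fst (z t))) \<partial>noise n)"
  by (subst integral_noise_swap[symmetric])
    (measurable, auto intro!: Bochner_Integration.integral_cong arg_cong[where f=ln] mix_cong)

text \<open>The number n (ln pi + 1) is the differential entropy in nats of n unit complex
  Gaussians, the reference level for all other entropies.\<close>

lemma integral_ln_Phi:
  "integrable (noise n) (\<lambda>z. ln (Phi n (\<lambda>t. fst (z t))))"
  "integrable (noise n) (\<lambda>z. ln (Phi n (\<lambda>t. snd (z t))))"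
  "(\<integral>z. ln (Phi n (\<lambda>t. fst (z t))) \<partial>noise n) = - real n * (ln pi + 1)"
  "(\<integral>z. ln (Phi n (\<lambda>t. snd (z t))) \<partial>noise n) = - real n * (ln pi + 1)"
proof -
  interpret prob_space "noise n" by (rule prob_space_noise)
  show "integrable (noise n) (\<lambda>z. ln (Phi n (\<lambda>t. fst (z t))))"
    "integrable (noise n) (\<lambda>z. ln (Phi n (\<lambda>t. snd (z t))))"
    "(\<integral>z. ln (Phi n (\<lambda>t. fst (z t))) \<partial>noise n) = - real n * (ln pi + 1)"
    "(\<integral>z. ln (Phi n (\<lambda>t. snd (z t))) \<partial>noise n) = - real n * (ln pi + 1)"
    by (simp_all add: noise_sum_square ln_Phi prob_space algebra_simps)
qed

text \<open>Change of measure: the denominator is the true density of interference plus first noise,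
  times that of the second noise. After passing to Lebesgue measure and translating by the signals,
  the sum over \<open>b\<close> rebuilds \<open>card B\<close> times the mixture in the numerator,
  and the mixture cancels.\<close>

lemma marginalise_interference:
  assumes B: "finite B" "B \<noteq> {}" and [measurable]: "j \<in> borel_measurable (leb n)"
    and j: "\<And>z. j z \<ge> 0"
  shows "(\<Sum>b\<in>B. \<integral>\<^sup>+z. ennreal (j (offset n (\<lambda>t. u t + w b t) v z)
        / (mix n B w (\<lambda>t. w b t + fst (z t)) * Phi n (\<lambda>t. snd (z t)))) \<partial>noise n)
      = ennreal (card B) * (\<integral>\<^sup>+z. ennreal (j z) \<partial>leb n)"
proof -
  \<comment> \<open>The integrand in terms of the observed pair: subtracting \<open>u\<close> from
    the output leaves the noisy interference, and subtracting \<open>w b\<close> as well leaves the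
    noise.\<close>
  define F where "F b z = j z * Phi n (\<lambda>t. fst (z t) - u t - w b t) / mix n B w (\<lambda>t. fst (z t) - u t)" for b z
  have [measurable]: "F b \<in> borel_measurable (leb n)" for b
    unfolding F_def by measurable
  have eq: "(\<integral>\<^sup>+z. ennreal (j (offset n (\<lambda>t. u t + w b t) v z)
        / (mix n B w (\<lambda>t. w b t + fst (z t)) * Phi n (\<lambda>t. snd (z t)))) \<partial>noise n)
      = (\<integral>\<^sup>+z. ennreal (F b z) \<partial>leb n)" (is "?l = _") if "b \<in> B" for b
  proof -
    have "?l = (\<integral>\<^sup>+z. ennreal (F b (offset n (\<lambda>t. u t + w b t) v z)) \<partial>leb n)"
      unfolding noise_density
    proof (subst nn_integral_density, measurable, intro nn_integral_cong)
      fix z :: "nat \<Rightarrow> complex \<times> complex"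
      have 1: "Phi n (\<lambda>t. fst (offset n (\<lambda>t. u t + w b t) v z t) - u t - w b t) = Phi n (\<lambda>t. fst (z t))"
        by (intro Phi_cong) (simp add: offset_def)
      have 2: "mix n B w (\<lambda>t. fst (offset n (\<lambda>t. u t + w b t) v z t) - u t) = mix n B w (\<lambda>t. w b t + fst (z t))"
        by (intro mix_cong) (simp add: offset_def)
      have p: "mix n B w (\<lambda>t. w b t + fst (z t)) > 0" "Phi n (\<lambda>t. snd (z t)) > 0" "Phi n (\<lambda>t. fst (z t)) > 0"
        using B by (simp_all add: mix_pos Phi_pos)
      show "ennreal (Phi n (\<lambda>t. fst (z t)) * Phi n (\<lambda>t. snd (z t))) * ennreal (j (offset n (\<lambda>t. u t + w b t) v z)
        / (mix n B w (\<lambda>t. w b t + fst (z t)) * Phi n (\<lambda>t. snd (z t))))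
        = ennreal (F b (offset n (\<lambda>t. u t + w b t) v z))"
        unfolding F_def 1 2 using p j
        by (subst ennreal_mult'[symmetric]) (auto intro!: arg_cong[where f=ennreal] simp: field_simps)
    qed
    also have "\<dots> = (\<integral>\<^sup>+z. ennreal (F b z) \<partial>leb n)"
      by (rule nn_integral_leb_offset) measurable
    finally show ?thesis .
  qed
  have "(\<Sum>b\<in>B. \<integral>\<^sup>+z. ennreal (F b z) \<partial>leb n) = (\<integral>\<^sup>+z. (\<Sum>b\<in>B. ennreal (F b z)) \<partial>leb n)"
    by (rule nn_integral_sum[symmetric]) measurable
  also have "\<dots> = (\<integral>\<^sup>+z. ennreal (card B) * ennreal (j z) \<partial>leb n)"
  proof (rule nn_integral_cong)
    fix z :: "nat \<Rightarrow> complex \<times> complex"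
    have p: "mix n B w (\<lambda>t. fst (z t) - u t) > 0" using B by (simp add: mix_pos)
    have c: "card B > 0" using B by (simp add: card_gt_0_iff)
    have "(\<Sum>b\<in>B. ennreal (F b z)) = ennreal (\<Sum>b\<in>B. F b z)"
      using p j by (intro sum_ennreal) (auto simp: F_def Phi_pos less_imp_le)
    also have "(\<Sum>b\<in>B. F b z) = j z * (\<Sum>b\<in>B. Phi n (\<lambda>t. fst (z t) - u t - w b t)) / mix n B w (\<lambda>t. fst (z t) - u t)"
      unfolding F_def by (simp add: sum_distrib_left sum_divide_distrib)
    also have "(\<Sum>b\<in>B. Phi n (\<lambda>t. fst (z t) - u t - w b t)) = card B * mix n B w (\<lambda>t. fst (z t) - u t)"
      unfolding mix_def using c by simp
    finally show "(\<Sum>b\<in>B. ennreal (F b z)) = ennreal (card B) * ennreal (j z)"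
      using p j by (simp add: ennreal_mult' mult.commute)
  qed
  also have "\<dots> = ennreal (card B) * (\<integral>\<^sup>+z. ennreal (j z) \<partial>leb n)"
    by (rule nn_integral_cmult) measurable
  finally show ?thesis using eq by simp
qed

subsection \<open>The likelihood ratio bound\<close>

lemma ln_qdens: "\<sigma> > 0 \<Longrightarrow> ln (qdens \<sigma> x) = - (ln pi + ln \<sigma>) - (cmod x)\<^sup>2 / \<sigma>"
  by (simp add: qdens_def ln_div ln_mult)

text \<open>Comparison density of the outputs given the side information: independent Gaussians
  around an affine estimate with offset \<open>m\<close> and slope \<open>k\<close>. Its logarithm
  is quadratic, so only second moments of the true signals enter.\<close>

definition qlik :: "nat \<Rightarrow> real \<Rightarrow> (nat \<Rightarrow> complex) \<Rightarrow> complex \<Rightarrow> (nat \<Rightarrow> complex \<times> complex) \<Rightarrow> real" where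
  "qlik n \<sigma> m k z = (\<Prod>t<n. qdens \<sigma> (fst (z t) - m t - k * snd (z t)))"

lemma qlik_pos: "\<sigma> > 0 \<Longrightarrow> qlik n \<sigma> m k z > 0"
  by (simp add: qlik_def qdens_pos prod_pos)

lemma qlik_measurable [measurable]: "qlik n \<sigma> m k \<in> borel_measurable (leb n)"
  unfolding qlik_def[abs_def] by (intro borel_measurable_prod measurable_compose[OF _ qdens_measurable]) auto

text \<open>Expanding the mixture over its codewords leaves products over time of joint densities of
  mass 1.\<close>

lemma nn_integral_qlik_mix:
  assumes "\<sigma> > 0" and A: "finite A" "A \<noteq> {}"
  shows "(\<integral>\<^sup>+z. ennreal (qlik n \<sigma> m k z * mix n A v (\<lambda>t. snd (z t))) \<partial>leb n) = 1"
proof -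
  have c: "card A > 0" using A by (simp add: card_gt_0_iff)
  have one: "(\<integral>\<^sup>+z. ennreal (qlik n \<sigma> m k z * Phi n (\<lambda>t. snd (z t) - v a t)) \<partial>leb n) = 1" for a
  proof -
    have "(\<integral>\<^sup>+z. ennreal (qlik n \<sigma> m k z * Phi n (\<lambda>t. snd (z t) - v a t)) \<partial>leb n)
      = (\<integral>\<^sup>+z. (\<Prod>t<n. ennreal (qdens \<sigma> (fst (z t) - m t - k * snd (z t)) * gdens (snd (z t) - v a t))) \<partial>leb n)"
      using \<open>\<sigma> > 0\<close> by (intro nn_integral_cong, subst prod_ennreal)
        (auto simp: qlik_def Phi_def qdens_pos gdens_pos less_imp_le prod.distrib)
    also have "\<dots> = (\<Prod>t<n. \<integral>\<^sup>+z. ennreal (qdens \<sigma> (fst z - m t - k * snd z) * gdens (snd z - v a t)) \<partial>lborel)"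
      unfolding leb_def
      by (rule LB.product_nn_integral_prod[where f="\<lambda>t z. ennreal (qdens \<sigma> (fst z - m t - k * snd z) * gdens (snd z - v a t))"]) auto
    also have "\<dots> = 1" using \<open>\<sigma> > 0\<close> by (simp add: nn_integral_conditional_gauss)
    finally show ?thesis .
  qed
  have "(\<integral>\<^sup>+z. ennreal (qlik n \<sigma> m k z * mix n A v (\<lambda>t. snd (z t))) \<partial>leb n)
     = (\<integral>\<^sup>+z. (\<Sum>a\<in>A. ennreal (qlik n \<sigma> m k z * Phi n (\<lambda>t. snd (z t) - v a t)) * ennreal (1 / card A)) \<partial>leb n)"
    using \<open>\<sigma> > 0\<close>
    by (intro nn_integral_cong)
      (simp add: mix_def sum_distrib_left sum_divide_distrib qlik_pos Phi_pos less_imp_le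
        flip: ennreal_mult')
  also have "\<dots> = (\<Sum>a\<in>A. ennreal (1 / card A))"
    by (subst nn_integral_sum) (auto simp: nn_integral_multc one)
  also have "\<dots> = 1"
    using c by (simp add: ennreal_of_nat_eq_real_of_nat flip: ennreal_mult')
  finally show ?thesis .
qed

lemma ln_qlik: "\<sigma> > 0 \<Longrightarrow> ln (qlik n \<sigma> m k z)
   = - real n * (ln pi + ln \<sigma>) - (\<Sum>t<n. (cmod (fst (z t) - m t - k * snd (z t)))\<^sup>2) / \<sigma>"
  unfolding qlik_def
  by (subst ln_prod) (auto simp: qdens_pos less_imp_neq[symmetric] ln_qdens sum_subtractf sum.distrib
      sum_divide_distrib algebra_simps)

lemma integral_ln_qlik:
  assumes "\<sigma> > 0"
  shows "integrable (noise n) (\<lambda>z. ln (qlik n \<sigma> m k (offset n x v z)))"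
    "(\<integral>z. ln (qlik n \<sigma> m k (offset n x v z)) \<partial>noise n) = - real n * (ln pi + ln \<sigma>)
       - ((\<Sum>t<n. (cmod (x t - m t - k * v t))\<^sup>2) + n * (1 + (cmod k)\<^sup>2)) / \<sigma>"
proof -
  interpret prob_space "noise n" by (rule prob_space_noise)
  \<comment> \<open>The residual at time t is the noiseless error plus the first noise minus
    \<open>k\<close> times the second, so the noises add 1 + |k|^2 to its mean square.\<close>
  have eq: "ln (qlik n \<sigma> m k (offset n x v z)) = - real n * (ln pi + ln \<sigma>)
      - (\<Sum>t<n. (cmod ((x t - m t - k * v t) + 1 * fst (z t) + (- k) * snd (z t)))\<^sup>2) / \<sigma>" for z
  proof -
    have "offset n x v z t = (x t + fst (z t), v t + snd (z t))" if "t < n" for t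
      using that by (cases "z t") (simp add: offset_def)
    then show ?thesis
      unfolding ln_qlik[OF assms]
      by (intro arg_cong2[where f="(-)"] arg_cong2[where f="(/)"] sum.cong refl
        arg_cong[where f="\<lambda>x. (cmod x)\<^sup>2"]) (auto simp: algebra_simps)
  qed
  have i: "integrable (noise n) (\<lambda>z. \<Sum>t<n. (cmod ((x t - m t - k * v t) + 1 * fst (z t) + (- k) * snd (z t)))\<^sup>2)"
    by (intro Bochner_Integration.integrable_sum)
      (use noise_square in \<open>auto simp only: has_bochner_integral_iff lessThan_iff\<close>)
  have "(\<integral>z. (\<Sum>t<n. (cmod ((x t - m t - k * v t) + 1 * fst (z t) + (- k) * snd (z t)))\<^sup>2) \<partial>noise n)
      = (\<Sum>t<n. \<integral>z. (cmod ((x t - m t - k * v t) + 1 * fst (z t) + (- k) * snd (z t)))\<^sup>2 \<partial>noise n)"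
    by (intro Bochner_Integration.integral_sum)
      (use noise_square in \<open>auto simp only: has_bochner_integral_iff lessThan_iff\<close>)
  also have "\<dots> = (\<Sum>t<n. (cmod (x t - m t - k * v t))\<^sup>2 + (cmod 1)\<^sup>2 + (cmod (- k))\<^sup>2)"
    by (intro sum.cong refl)
      (use noise_square in \<open>auto simp only: has_bochner_integral_iff lessThan_iff\<close>)
  finally have v: "(\<integral>z. (\<Sum>t<n. (cmod ((x t - m t - k * v t) + 1 * fst (z t) + (- k) * snd (z t)))\<^sup>2) \<partial>noise n)
      = (\<Sum>t<n. (cmod (x t - m t - k * v t))\<^sup>2) + n * (1 + (cmod k)\<^sup>2)"
    by (simp add: sum.distrib algebra_simps)
  show "integrable (noise n) (\<lambda>z. ln (qlik n \<sigma> m k (offset n x v z)))"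
    unfolding eq using i by (intro Bochner_Integration.integrable_diff integrable_const Bochner_Integration.integrable_divide)
  show "(\<integral>z. ln (qlik n \<sigma> m k (offset n x v z)) \<partial>noise n) = - real n * (ln pi + ln \<sigma>)
       - ((\<Sum>t<n. (cmod (x t - m t - k * v t))\<^sup>2) + n * (1 + (cmod k)\<^sup>2)) / \<sigma>"
    unfolding eq using i
    by (subst Bochner_Integration.integral_diff) (auto simp only: integrable_const Bochner_Integration.integrable_divide integral_divide_zero v
      lebesgue_integral_const prob_space scaleR_one)
qed

text \<open>Gibbs' inequality for the comparison law of messages, output and side information
  against the true law. By \<open>power\<close>, the mean square residual, noises included, averages
  at most \<open>\<sigma>\<close> per time. The Gaussian factor therefore costs at most n (ln pi +
  ln \<sigma> + 1), of which the entropy of the second noise returns n (ln pi + 1).\<close>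

lemma converse:
  fixes u v :: "'c \<Rightarrow> 'a \<Rightarrow> nat \<Rightarrow> complex" and w :: "'c \<Rightarrow> 'b \<Rightarrow> nat \<Rightarrow> complex"
    and \<kappa> :: "'c \<Rightarrow> 'a \<Rightarrow> (nat \<Rightarrow> complex \<times> complex) \<Rightarrow> real"
  assumes C: "finite C" "C \<noteq> {}" and A: "finite A" "A \<noteq> {}" and B: "finite B" "B \<noteq> {}"
    and \<sigma>: "\<sigma> > 0"
    and \<kappa>_meas: "\<And>c a. c \<in> C \<Longrightarrow> a \<in> A \<Longrightarrow> \<kappa> c a \<in> borel_measurable (leb n)"
    and \<kappa>_pos: "\<And>c a z. \<kappa> c a z > 0"
    and \<kappa>_norm: "(\<Sum>c\<in>C. \<Sum>a\<in>A. \<integral>\<^sup>+z. ennreal (\<kappa> c a z *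
        (qlik n \<sigma> (m c) k z * mix n A (v c) (\<lambda>t. snd (z t)))) \<partial>leb n) \<le> 1"
    and \<kappa>_int: "\<And>c a b. c \<in> C \<Longrightarrow> a \<in> A \<Longrightarrow> b \<in> B \<Longrightarrow>
        integrable (noise n) (\<lambda>z. ln (\<kappa> c a (offset n (\<lambda>t. u c a t + w c b t) (v c a) z)))"
    and power: "(\<Sum>c\<in>C. \<Sum>a\<in>A. \<Sum>b\<in>B. \<Sum>t<n. (cmod (u c a t + w c b t - m c t - k * v c a t))\<^sup>2)
        \<le> card C * card A * card B * (n * (\<sigma> - 1 - (cmod k)\<^sup>2))"
  shows "ln (card C * card A)
       + (\<Sum>c\<in>C. \<Sum>a\<in>A. \<Sum>b\<in>B. \<integral>z. ln (\<kappa> c a (offset n (\<lambda>t. u c a t + w c b t) (v c a) z)) \<partial>noise n)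
           / (card C * card A * card B)
     \<le> n * ln \<sigma> + hmix n C A v - hmix n C B w"
proof -
  interpret prob_space "noise n" by (rule prob_space_noise)
  define N where "N = real (card C * card A)"
  have cp: "real (card C) > 0" "real (card A) > 0" "real (card B) > 0"
    using A B C by (simp_all add: card_gt_0_iff)
  then have N: "N > 0" by (simp add: N_def)
  define sh where "sh c a b z = offset n (\<lambda>t. u c a t + w c b t) (v c a) z" for c a b z
  \<comment> \<open>The factor \<open>N\<close> compensates the probability 1/\<open>N\<close> of a
    message pair. In \<open>f\<close> the true densities given the pair are the interference mixture
    for the output and \<open>Phi\<close> for the side information.\<close>
  define J where "J c a z = N * (\<kappa> c a z * (qlik n \<sigma> (m c) k z * mix n A (v c) (\<lambda>t. snd (z t))))" for c a z
  define f where "f = (\<lambda>(c, a, b) z. J c a (sh c a b z)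
      / (mix n B (w c) (\<lambda>t. w c b t + fst (z t)) * Phi n (\<lambda>t. snd (z t))))"
  have Jm: "J c a \<in> borel_measurable (leb n)" if "c \<in> C" "a \<in> A" for c a
  proof -
    note \<kappa>_meas[OF that, measurable]
    show ?thesis unfolding J_def by measurable
  qed
  have Jp: "J c a z > 0" for c a z
    using N \<kappa>_pos \<sigma> A by (simp add: J_def qlik_pos mix_pos)
  have ln_f: "ln (f (c, a, b) z) = ln N + ln (\<kappa> c a (sh c a b z)) + ln (qlik n \<sigma> (m c) k (sh c a b z))
      + ln (mix n A (v c) (\<lambda>t. v c a t + snd (z t))) - ln (mix n B (w c) (\<lambda>t. w c b t + fst (z t)))
      - ln (Phi n (\<lambda>t. snd (z t)))" for c a b z
  proof -
    have "mix n A (v c) (\<lambda>t. snd (sh c a b z t)) = mix n A (v c) (\<lambda>t. v c a t + snd (z t))"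
      by (rule mix_cong) (simp add: sh_def offset_def)
    moreover have "\<kappa> c a (sh c a b z) > 0" "qlik n \<sigma> (m c) k (sh c a b z) > 0"
      "mix n A (v c) (\<lambda>t. v c a t + snd (z t)) > 0" "mix n B (w c) (\<lambda>t. w c b t + fst (z t)) > 0"
      "Phi n (\<lambda>t. snd (z t)) > 0"
      using \<kappa>_pos \<sigma> A B by (auto simp: qlik_pos mix_pos Phi_pos)
    ultimately show ?thesis
      unfolding f_def J_def using N by (simp add: ln_div ln_mult)
  qed
  have int_f: "integrable (noise n) (\<lambda>z. ln (f (c, a, b) z))"
    and integral_f: "(\<integral>z. ln (f (c, a, b) z) \<partial>noise n) = ln N + (\<integral>z. ln (\<kappa> c a (sh c a b z)) \<partial>noise n)
      - real n * ln \<sigma> + n - ((\<Sum>t<n. (cmod (u c a t + w c b t - m c t - k * v c a t))\<^sup>2) + n * (1 + (cmod k)\<^sup>2)) / \<sigma>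
      + (\<integral>z. ln (mix n A (v c) (\<lambda>t. v c a t + fst (z t))) \<partial>noise n)
      - (\<integral>z. ln (mix n B (w c) (\<lambda>t. w c b t + fst (z t))) \<partial>noise n)"
    if "c \<in> C" "a \<in> A" "b \<in> B" for c a b
  proof -
    note i = \<kappa>_int[OF that, folded sh_def] integral_ln_qlik(1)[OF \<sigma>, of n "m c" k "\<lambda>t. u c a t + w c b t" "v c a", folded sh_def]
      integrable_ln_mix(2)[OF A(1) that(2), of n "v c"] integrable_ln_mix(1)[OF B(1) that(3), of n "w c"]
      integral_ln_Phi(2)[of n]
    show "integrable (noise n) (\<lambda>z. ln (f (c, a, b) z))"
      unfolding ln_f using i by auto
    show "(\<integral>z. ln (f (c, a, b) z) \<partial>noise n) = ln N + (\<integral>z. ln (\<kappa> c a (sh c a b z)) \<partial>noise n)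
      - real n * ln \<sigma> + n - ((\<Sum>t<n. (cmod (u c a t + w c b t - m c t - k * v c a t))\<^sup>2) + n * (1 + (cmod k)\<^sup>2)) / \<sigma>
      + (\<integral>z. ln (mix n A (v c) (\<lambda>t. v c a t + fst (z t))) \<partial>noise n)
      - (\<integral>z. ln (mix n B (w c) (\<lambda>t. w c b t + fst (z t))) \<partial>noise n)"
      unfolding ln_f using i
      by (simp add: prob_space integral_ln_Phi(4) integral_ln_mix_snd
          integral_ln_qlik(2)[OF \<sigma>, of n "m c" k "\<lambda>t. u c a t + w c b t" "v c a", folded sh_def])
        (simp add: algebra_simps)
  qed
  have "(\<Sum>p\<in>C \<times> A \<times> B. \<integral>z. ln (f p z) \<partial>noise n) \<le> 0"
  proof (rule integral_ln_le_0)
    show "f p \<in> borel_measurable (noise n)" if "p \<in> C \<times> A \<times> B" for p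
    proof -
      obtain c a b where p: "p = (c, a, b)" by (cases p)
      have [measurable]: "J c a \<in> borel_measurable (leb n)" using that p Jm by auto
      show ?thesis unfolding p f_def sh_def by simp measurable
    qed
    show "f p z > 0" for p z
      unfolding f_def using Jp B by (auto simp: mix_pos Phi_pos split: prod.split)
    show "integrable (noise n) (\<lambda>z. ln (f p z))" if "p \<in> C \<times> A \<times> B" for p
      using that int_f by auto
    have "(\<Sum>p\<in>C \<times> A \<times> B. \<integral>\<^sup>+z. ennreal (f p z) \<partial>noise n)
       = (\<Sum>c\<in>C. \<Sum>a\<in>A. \<Sum>b\<in>B. \<integral>\<^sup>+z. ennreal (f (c, a, b) z) \<partial>noise n)"
      by (simp add: sum.cartesian_product)
    also have "\<dots> = (\<Sum>c\<in>C. \<Sum>a\<in>A. ennreal (card B) * (\<integral>\<^sup>+z. ennreal (J c a z) \<partial>leb n))"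
      unfolding f_def prod.case sh_def
      by (intro sum.cong refl marginalise_interference B Jm Jp less_imp_le)
    also have "\<dots> = (\<Sum>c\<in>C. \<Sum>a\<in>A. ennreal (card B) * (ennreal N * (\<integral>\<^sup>+z. ennreal (\<kappa> c a z *
        (qlik n \<sigma> (m c) k z * mix n A (v c) (\<lambda>t. snd (z t)))) \<partial>leb n)))"
    proof (intro sum.cong refl arg_cong2[where f="(*)"])
      fix c a assume "c \<in> C" "a \<in> A"
      note \<kappa>_meas[OF this, measurable]
      show "(\<integral>\<^sup>+z. ennreal (J c a z) \<partial>leb n) = ennreal N * (\<integral>\<^sup>+z. ennreal (\<kappa> c a z *
        (qlik n \<sigma> (m c) k z * mix n A (v c) (\<lambda>t. snd (z t)))) \<partial>leb n)"
        using N by (subst nn_integral_cmult[symmetric]) (auto simp: J_def ennreal_mult' intro!: nn_integral_cong)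
    qed
    also have "\<dots> = ennreal (card B * N) * (\<Sum>c\<in>C. \<Sum>a\<in>A. \<integral>\<^sup>+z. ennreal (\<kappa> c a z *
        (qlik n \<sigma> (m c) k z * mix n A (v c) (\<lambda>t. snd (z t)))) \<partial>leb n)"
      using N by (simp add: sum_distrib_left mult.assoc ennreal_mult')
    also have "\<dots> \<le> ennreal (card B * N) * 1"
      by (intro mult_left_mono \<kappa>_norm) auto
    also have "\<dots> = ennreal (card (C \<times> A \<times> B))"
      by (simp add: N_def card_cartesian_product mult_ac)
    finally show "(\<Sum>p\<in>C \<times> A \<times> B. \<integral>\<^sup>+z. ennreal (f p z) \<partial>noise n) \<le> ennreal (card (C \<times> A \<times> B))" .
  qed (use A B C in auto)
  also have "(\<Sum>p\<in>C \<times> A \<times> B. \<integral>z. ln (f p z) \<partial>noise n) = (\<Sum>c\<in>C. \<Sum>a\<in>A. \<Sum>b\<in>B. \<integral>z. ln (f (c, a, b) z) \<partial>noise n)"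
    by (simp add: sum.cartesian_product)
  also have "\<dots> = (\<Sum>c\<in>C. \<Sum>a\<in>A. \<Sum>b\<in>B. (ln N - real n * ln \<sigma> + n - real n * (1 + (cmod k)\<^sup>2) / \<sigma>)
        + (\<integral>z. ln (\<kappa> c a (sh c a b z)) \<partial>noise n)
        - (\<Sum>t<n. (cmod (u c a t + w c b t - m c t - k * v c a t))\<^sup>2) / \<sigma>
        + (\<integral>z. ln (mix n A (v c) (\<lambda>t. v c a t + fst (z t))) \<partial>noise n)
        - (\<integral>z. ln (mix n B (w c) (\<lambda>t. w c b t + fst (z t))) \<partial>noise n))"
    by (intro sum.cong refl) (simp add: integral_f add_divide_distrib)
  also have "\<dots> = card C * card A * card B * (ln N - real n * ln \<sigma> + n - real n * (1 + (cmod k)\<^sup>2) / \<sigma>)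
      + (\<Sum>c\<in>C. \<Sum>a\<in>A. \<Sum>b\<in>B. \<integral>z. ln (\<kappa> c a (sh c a b z)) \<partial>noise n)
      - (\<Sum>c\<in>C. \<Sum>a\<in>A. \<Sum>b\<in>B. \<Sum>t<n. (cmod (u c a t + w c b t - m c t - k * v c a t))\<^sup>2) / \<sigma>
      - card C * card A * card B * hmix n C A v + card C * card A * card B * hmix n C B w"
  proof -
    have "(\<Sum>c\<in>C. \<Sum>a\<in>A. \<Sum>b\<in>B. \<integral>z. ln (mix n A (v c) (\<lambda>t. v c a t + fst (z t))) \<partial>noise n)
        = - (card C * card A * card B * hmix n C A v)"
      unfolding hmix_def using cp by (simp add: field_simps sum_distrib_left)
    moreover have "(\<Sum>c\<in>C. \<Sum>a\<in>A. \<Sum>b\<in>B. \<integral>z. ln (mix n B (w c) (\<lambda>t. w c b t + fst (z t))) \<partial>noise n)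
        = - (card C * card A * card B * hmix n C B w)"
      unfolding hmix_def using cp by (simp add: field_simps sum_distrib_left)
    ultimately show ?thesis
      by (simp add: sum.distrib sum_subtractf sum_divide_distrib)
  qed
  finally have main: "card C * card A * card B * (ln N - real n * ln \<sigma> + n - real n * (1 + (cmod k)\<^sup>2) / \<sigma>)
      + (\<Sum>c\<in>C. \<Sum>a\<in>A. \<Sum>b\<in>B. \<integral>z. ln (\<kappa> c a (sh c a b z)) \<partial>noise n)
      - (\<Sum>c\<in>C. \<Sum>a\<in>A. \<Sum>b\<in>B. \<Sum>t<n. (cmod (u c a t + w c b t - m c t - k * v c a t))\<^sup>2) / \<sigma>
      - card C * card A * card B * hmix n C A v + card C * card A * card B * hmix n C B w \<le> 0" .
  define M where "M = real (card C * card A * card B)"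
  define K where "K = (\<Sum>c\<in>C. \<Sum>a\<in>A. \<Sum>b\<in>B. \<integral>z. ln (\<kappa> c a (sh c a b z)) \<partial>noise n)"
  have M: "M > 0" using cp by (simp add: M_def)
  \<comment> \<open>Divided by \<open>\<sigma>\<close>, the power budget is exactly what remains of
    \<open>n\<close> after the noise part of the residual, so only the term with
    \<open>ln \<sigma>\<close> survives.\<close>
  have "(\<Sum>c\<in>C. \<Sum>a\<in>A. \<Sum>b\<in>B. \<Sum>t<n. (cmod (u c a t + w c b t - m c t - k * v c a t))\<^sup>2) / \<sigma>
      \<le> M * (n * (\<sigma> - 1 - (cmod k)\<^sup>2)) / \<sigma>"
    using power \<sigma> by (intro divide_right_mono) (auto simp: M_def)
  also have "\<dots> = M * (n - real n * (1 + (cmod k)\<^sup>2) / \<sigma>)"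
    using \<sigma> by (simp add: field_simps)
  finally have "M * (ln N - real n * ln \<sigma> + n - real n * (1 + (cmod k)\<^sup>2) / \<sigma>) + K
     - M * (n - real n * (1 + (cmod k)\<^sup>2) / \<sigma>) - M * hmix n C A v + M * hmix n C B w \<le> 0"
    using main by (simp add: M_def K_def)
  moreover have "M * (K / M) = K" using M by simp
  ultimately have "M * (ln N + K / M) \<le> M * (n * ln \<sigma> + hmix n C A v - hmix n C B w)"
    by (simp add: algebra_simps)
  then have "ln N + K / M \<le> n * ln \<sigma> + hmix n C A v - hmix n C B w"
    using M by (simp only: mult_le_cancel_left_pos)
  then show ?thesis by (simp add: N_def M_def K_def sh_def)
qed

subsection \<open>Bounds for one receiver\<close>

text \<open>With \<open>D\<close> saying that the decoder output agrees with a given message, this is a conditional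
  sub-probability of that message given the output, and its expected logarithm is affine in the error
  probability.\<close>

definition dker :: "nat \<Rightarrow> real \<Rightarrow> real \<Rightarrow> ((nat \<Rightarrow> complex) \<Rightarrow> bool) \<Rightarrow> (nat \<Rightarrow> complex \<times> complex) \<Rightarrow> real" where
  "dker n r L D z = (if D (\<lambda>t\<in>{..<n}. fst (z t)) then 1 / 2 else 1 / (2 * L)) / r"

lemma dker_pos: "r > 0 \<Longrightarrow> L > 0 \<Longrightarrow> dker n r L D z > 0"
  by (simp add: dker_def)

lemma received_measurable [measurable]:
  "(\<lambda>z. \<lambda>t\<in>{..<n}. x t + fst (z t)) \<in> measurable (leb n) (outspace n)"
  "(\<lambda>z. \<lambda>t\<in>{..<n}. fst (z t)) \<in> measurable (leb n) (outspace n)"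
  unfolding outspace_def by (auto intro!: measurable_restrict)

lemma dker_measurable [measurable]:
  assumes [measurable]: "Measurable.pred (outspace n) D"
  shows "dker n r L D \<in> borel_measurable (leb n)"
  unfolding dker_def[abs_def] by measurable

lemma integral_ln_dker:
  assumes r: "r > 0" and L: "L > 0" and [measurable]: "Measurable.pred (outspace n) D"
  shows "integrable (noise n) (\<lambda>z. ln (dker n r L D (offset n x v z)))"
    "(\<integral>z. ln (dker n r L D (offset n x v z)) \<partial>noise n) = - ln r - ln 2
       - ln L * measure (noise n) {z \<in> space (noise n). \<not> D (\<lambda>t\<in>{..<n}. x t + fst (z t))}"
proof -
  interpret prob_space "noise n" by (rule prob_space_noise)
  define E where "E = {z \<in> space (noise n). \<not> D (\<lambda>t\<in>{..<n}. x t + fst (z t))}"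
  have [measurable]: "E \<in> sets (noise n)" unfolding E_def by measurable
  have eq: "ln (dker n r L D (offset n x v z)) = - ln r - ln 2 - ln L * indicator E z"
    if "z \<in> space (noise n)" for z
  proof -
    have "(\<lambda>t\<in>{..<n}. fst (offset n x v z t)) = (\<lambda>t\<in>{..<n}. x t + fst (z t))"
      by (rule restrict_ext) (simp add: offset_def)
    then show ?thesis
      using r L that by (simp add: dker_def E_def ln_div ln_mult)
  qed
  show "integrable (noise n) (\<lambda>z. ln (dker n r L D (offset n x v z)))"
    by (subst Bochner_Integration.integrable_cong[OF refl eq]) (auto simp: emeasure_eq_measure)
  have "(\<integral>z. ln (dker n r L D (offset n x v z)) \<partial>noise n)
      = (\<integral>z. - ln r - ln 2 - ln L * indicator E z \<partial>noise n)"
    by (rule Bochner_Integration.integral_cong[OF refl eq])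
  also have "\<dots> = - ln r - ln 2 - ln L * prob E"
    by (subst Bochner_Integration.integral_diff) (auto simp: emeasure_eq_measure prob_space)
  finally show "(\<integral>z. ln (dker n r L D (offset n x v z)) \<partial>noise n) = - ln r - ln 2
       - ln L * measure (noise n) {z \<in> space (noise n). \<not> D (\<lambda>t\<in>{..<n}. x t + fst (z t))}"
    by (simp add: E_def)
qed

text \<open>With \<open>L = card S / r\<close>, the messages that disagree with the output weigh
  1/(2 card S) each, in total at most 1/2. At most \<open>r\<close> messages agree with it, and they
  weigh 1/(2r) each.\<close>

lemma sum_dker_le:
  fixes r :: real
  assumes S: "finite S" "S \<noteq> {}" and r: "r > 0"
    and D: "\<And>y. card {p \<in> S. D p y} \<le> r"
  shows "(\<Sum>p\<in>S. dker n r (card S / r) (D p) z) \<le> 1"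
proof -
  define y where "y = (\<lambda>t\<in>{..<n}. fst (z t))"
  have c: "card S > 0" using S by (simp add: card_gt_0_iff)
  have "(\<Sum>p\<in>S. dker n r (card S / r) (D p) z) \<le> (\<Sum>p\<in>S. (if D p y then 1 / (2 * r) else 0) + 1 / (2 * card S))"
    using r c by (intro sum_mono) (auto simp: dker_def y_def field_simps)
  also have "\<dots> = card {p \<in> S. D p y} / (2 * r) + 1 / 2"
    using S c by (simp add: sum.distrib sum.If_cases Int_def)
  also have "\<dots> \<le> 1" using D[of y] r by (simp add: field_simps)
  finally show ?thesis .
qed

text \<open>The first noise is used for either receiver; receiver 2 is brought to this form by
  exchanging the noises.\<close>

definition err :: "nat \<Rightarrow> 'c set \<Rightarrow> 'a set \<Rightarrow> 'b set \<Rightarrow> ('c \<Rightarrow> 'a \<Rightarrow> nat \<Rightarrow> complex) \<Rightarrow> ('c \<Rightarrow> 'b \<Rightarrow> nat \<Rightarrow> complex) \<Rightarrow>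
    ('c \<Rightarrow> 'a \<Rightarrow> (nat \<Rightarrow> complex) \<Rightarrow> bool) \<Rightarrow> real" where
  "err n C A B u w D = (\<Sum>c\<in>C. \<Sum>a\<in>A. \<Sum>b\<in>B. measure (noise n)
      {z \<in> space (noise n). \<not> D c a (\<lambda>t\<in>{..<n}. u c a t + w c b t + fst (z t))})
     / (card C * card A * card B)"

text \<open>The common message is treated as known, so the offset \<open>m\<close> may depend on it,
  and \<open>D1\<close> allows one private message per output. The loss \<open>ln 2\<close> is the
  price of giving only half of the mass to the decoder output.\<close>

lemma private_message_bound:
  fixes u v :: "'c \<Rightarrow> 'a \<Rightarrow> nat \<Rightarrow> complex" and w :: "'c \<Rightarrow> 'b \<Rightarrow> nat \<Rightarrow> complex"
  assumes C: "finite C" "C \<noteq> {}" and A: "finite A" "A \<noteq> {}" and B: "finite B" "B \<noteq> {}"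
    and \<sigma>: "\<sigma> > 0"
    and D: "\<And>c a. Measurable.pred (outspace n) (D c a)"
    and D1: "\<And>c a a' y. D c a y \<Longrightarrow> D c a' y \<Longrightarrow> a = a'"
    and power: "(\<Sum>c\<in>C. \<Sum>a\<in>A. \<Sum>b\<in>B. \<Sum>t<n. (cmod (u c a t + w c b t - m c t - k * v c a t))\<^sup>2)
        \<le> card C * card A * card B * (n * (\<sigma> - 1 - (cmod k)\<^sup>2))"
  shows "(1 - err n C A B u w D) * ln (card A) \<le> ln 2 + n * ln \<sigma> + hmix n C A v - hmix n C B w"
proof -
  have cp: "real (card C) > 0" "real (card A) > 0" "real (card B) > 0"
    using A B C by (simp_all add: card_gt_0_iff)
  \<comment> \<open>The factor 1/\<open>card C\<close> draws \<open>c\<close> uniformly; its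
    logarithm later cancels \<open>ln (card C)\<close>, and only the rate of \<open>a\<close> is
    left.\<close>
  define \<kappa> where "\<kappa> c a = dker n (card C) (card A) (D c a)" for c a
  have \<kappa>_sum: "(\<Sum>a\<in>A. \<kappa> c a z) \<le> 1 / card C" for c z
  proof -
    have "card {a \<in> A. D c a y} \<le> 1" for y
      using A D1[of c _ y] by (intro card_le_Suc0_iff_eq[THEN iffD2, folded One_nat_def]) auto
    from sum_dker_le[OF A, of 1 "D c" n z] this
    have "(\<Sum>a\<in>A. dker n 1 (card A) (D c a) z) \<le> 1" by simp
    then show ?thesis
      using cp by (simp add: \<kappa>_def dker_def field_simps flip: sum_divide_distrib)
  qed
  have [measurable]: "\<kappa> c a \<in> borel_measurable (leb n)" for c a
    unfolding \<kappa>_def using D by measurable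
  have norm: "(\<Sum>c\<in>C. \<Sum>a\<in>A. \<integral>\<^sup>+z. ennreal (\<kappa> c a z *
        (qlik n \<sigma> (m c) k z * mix n A (v c) (\<lambda>t. snd (z t)))) \<partial>leb n) \<le> 1"
  proof -
    have "(\<Sum>a\<in>A. \<integral>\<^sup>+z. ennreal (\<kappa> c a z *
        (qlik n \<sigma> (m c) k z * mix n A (v c) (\<lambda>t. snd (z t)))) \<partial>leb n) \<le> ennreal (1 / card C)" for c
    proof -
      have "(\<Sum>a\<in>A. \<integral>\<^sup>+z. ennreal (\<kappa> c a z *
        (qlik n \<sigma> (m c) k z * mix n A (v c) (\<lambda>t. snd (z t)))) \<partial>leb n)
        = (\<integral>\<^sup>+z. (\<Sum>a\<in>A. ennreal (\<kappa> c a z *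
        (qlik n \<sigma> (m c) k z * mix n A (v c) (\<lambda>t. snd (z t))))) \<partial>leb n)"
        by (rule nn_integral_sum[symmetric]) measurable
      also have "\<dots> \<le> (\<integral>\<^sup>+z. ennreal (1 / card C) * ennreal
        (qlik n \<sigma> (m c) k z * mix n A (v c) (\<lambda>t. snd (z t))) \<partial>leb n)"
      proof (rule nn_integral_mono)
        fix z
        have p: "qlik n \<sigma> (m c) k z * mix n A (v c) (\<lambda>t. snd (z t)) > 0"
          using \<sigma> A by (simp add: qlik_pos mix_pos)
        have "(\<Sum>a\<in>A. ennreal (\<kappa> c a z * (qlik n \<sigma> (m c) k z * mix n A (v c) (\<lambda>t. snd (z t)))))
          = ennreal (\<Sum>a\<in>A. \<kappa> c a z * (qlik n \<sigma> (m c) k z * mix n A (v c) (\<lambda>t. snd (z t))))"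
          using \<sigma> A cp
          by (intro sum_ennreal mult_nonneg_nonneg) (auto simp: \<kappa>_def dker_pos qlik_pos mix_pos less_imp_le)
        also have "\<dots> \<le> ennreal (1 / card C * (qlik n \<sigma> (m c) k z * mix n A (v c) (\<lambda>t. snd (z t))))"
          unfolding sum_distrib_right[symmetric]
          using p by (intro ennreal_leI mult_right_mono \<kappa>_sum) auto
        finally show "(\<Sum>a\<in>A. ennreal (\<kappa> c a z * (qlik n \<sigma> (m c) k z * mix n A (v c) (\<lambda>t. snd (z t)))))
          \<le> ennreal (1 / card C) * ennreal (qlik n \<sigma> (m c) k z * mix n A (v c) (\<lambda>t. snd (z t)))"
          using p by (subst ennreal_mult'[symmetric]) auto
      qed
      also have "\<dots> = ennreal (1 / card C)"
        using \<sigma> A by (subst nn_integral_cmult) (auto simp: nn_integral_qlik_mix)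
      finally show ?thesis .
    qed
    then have "(\<Sum>c\<in>C. \<Sum>a\<in>A. \<integral>\<^sup>+z. ennreal (\<kappa> c a z *
        (qlik n \<sigma> (m c) k z * mix n A (v c) (\<lambda>t. snd (z t)))) \<partial>leb n) \<le> (\<Sum>c\<in>C. ennreal (1 / card C))"
      by (intro sum_mono)
    also have "\<dots> = 1"
      using cp by (simp add: ennreal_of_nat_eq_real_of_nat flip: ennreal_mult')
    finally show ?thesis .
  qed
  have "ln (card C * card A)
       + (\<Sum>c\<in>C. \<Sum>a\<in>A. \<Sum>b\<in>B. \<integral>z. ln (\<kappa> c a (offset n (\<lambda>t. u c a t + w c b t) (v c a) z)) \<partial>noise n)
           / (card C * card A * card B)
     \<le> n * ln \<sigma> + hmix n C A v - hmix n C B w"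
    by (rule converse[OF C A B \<sigma> _ _ norm _ power])
      (use cp D in \<open>auto simp: \<kappa>_def dker_pos integral_ln_dker\<close>)
  moreover have "(\<Sum>c\<in>C. \<Sum>a\<in>A. \<Sum>b\<in>B. \<integral>z. ln (\<kappa> c a (offset n (\<lambda>t. u c a t + w c b t) (v c a) z)) \<partial>noise n)
           / (card C * card A * card B) = - ln (card C) - ln 2 - ln (card A) * err n C A B u w D"
    using cp D by (simp add: \<kappa>_def integral_ln_dker err_def sum_subtractf diff_divide_distrib
        sum_distrib_left[symmetric])
  ultimately show ?thesis
    using cp by (simp add: ln_mult algebra_simps)
qed

text \<open>Here \<open>c\<close> is estimated too, so the comparison density of the output must not
  depend on it: the offset is 0 and the uncentred power enters. The number \<open>r\<close> of pairs
  matching one output leaves room for a component of \<open>c\<close> that the decoder does not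
  report.\<close>

lemma joint_message_bound:
  fixes u :: "'c \<Rightarrow> 'a \<Rightarrow> nat \<Rightarrow> complex" and w :: "'c \<Rightarrow> 'b \<Rightarrow> nat \<Rightarrow> complex" and \<sigma> r :: real
  assumes C: "finite C" "C \<noteq> {}" and A: "finite A" "A \<noteq> {}" and B: "finite B" "B \<noteq> {}"
    and \<sigma>: "\<sigma> > 0" and r: "r > 0"
    and D: "\<And>c a. Measurable.pred (outspace n) (D c a)"
    and D1: "\<And>y. card {p \<in> C \<times> A. D (fst p) (snd p) y} \<le> r"
    and power: "(\<Sum>c\<in>C. \<Sum>a\<in>A. \<Sum>b\<in>B. \<Sum>t<n. (cmod (u c a t + w c b t))\<^sup>2)
        \<le> card C * card A * card B * (n * (\<sigma> - 1))"
  shows "(1 - err n C A B u w D) * ln (card C * card A / r)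
     \<le> ln 2 + n * ln \<sigma> + hmix n C A (\<lambda>_ _ _. 0) - hmix n C B w"
proof -
  have cp: "real (card C) > 0" "real (card A) > 0" "real (card B) > 0"
    using A B C by (simp_all add: card_gt_0_iff)
  define L where "L = card C * card A / r"
  have L: "L > 0" using cp r by (simp add: L_def)
  define \<kappa> where "\<kappa> c a = dker n r L (D c a)" for c a
  have \<kappa>_sum: "(\<Sum>p\<in>C \<times> A. \<kappa> (fst p) (snd p) z) \<le> 1" for z
    using sum_dker_le[of "C \<times> A" r "\<lambda>p. D (fst p) (snd p)" n z] A C r D1
    by (simp add: \<kappa>_def L_def card_cartesian_product)
  have [measurable]: "\<kappa> c a \<in> borel_measurable (leb n)" for c a
    unfolding \<kappa>_def using D by measurable
  define \<rho> where "\<rho> z = qlik n \<sigma> (\<lambda>_. 0) 0 z * mix n A (\<lambda>_ _. 0) (\<lambda>t. snd (z t))" for z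
  have [measurable]: "\<rho> \<in> borel_measurable (leb n)" unfolding \<rho>_def by measurable
  have p: "\<rho> z > 0" for z using \<sigma> A by (simp add: \<rho>_def qlik_pos mix_pos)
  have norm: "(\<Sum>c\<in>C. \<Sum>a\<in>A. \<integral>\<^sup>+z. ennreal (\<kappa> c a z * \<rho> z) \<partial>leb n) \<le> 1"
  proof -
    have "(\<Sum>c\<in>C. \<Sum>a\<in>A. \<integral>\<^sup>+z. ennreal (\<kappa> c a z * \<rho> z) \<partial>leb n)
        = (\<Sum>p\<in>C \<times> A. \<integral>\<^sup>+z. ennreal (\<kappa> (fst p) (snd p) z * \<rho> z) \<partial>leb n)"
      by (simp add: sum.cartesian_product case_prod_beta')
    also have "\<dots> = (\<integral>\<^sup>+z. (\<Sum>p\<in>C \<times> A. ennreal (\<kappa> (fst p) (snd p) z * \<rho> z)) \<partial>leb n)"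
      by (rule nn_integral_sum[symmetric]) measurable
    also have "\<dots> \<le> (\<integral>\<^sup>+z. ennreal (\<rho> z) \<partial>leb n)"
    proof (rule nn_integral_mono)
      fix z
      have "(\<Sum>p\<in>C \<times> A. ennreal (\<kappa> (fst p) (snd p) z * \<rho> z)) = ennreal (\<Sum>p\<in>C \<times> A. \<kappa> (fst p) (snd p) z * \<rho> z)"
        using p r L by (intro sum_ennreal mult_nonneg_nonneg) (auto simp: \<kappa>_def dker_pos less_imp_le)
      also have "\<dots> \<le> ennreal (1 * \<rho> z)"
        unfolding sum_distrib_right[symmetric]
        using p by (intro ennreal_leI mult_right_mono \<kappa>_sum) (auto simp: less_imp_le)
      finally show "(\<Sum>p\<in>C \<times> A. ennreal (\<kappa> (fst p) (snd p) z * \<rho> z)) \<le> ennreal (\<rho> z)" by simp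
    qed
    also have "\<dots> = 1" unfolding \<rho>_def using \<sigma> A by (rule nn_integral_qlik_mix)
    finally show ?thesis .
  qed
  have "ln (card C * card A)
       + (\<Sum>c\<in>C. \<Sum>a\<in>A. \<Sum>b\<in>B. \<integral>z. ln (\<kappa> c a (offset n (\<lambda>t. u c a t + w c b t) (\<lambda>_. 0) z)) \<partial>noise n)
           / (card C * card A * card B)
     \<le> n * ln \<sigma> + hmix n C A (\<lambda>_ _ _. 0) - hmix n C B w"
    by (rule converse[OF C A B \<sigma>, where m="\<lambda>_ _. 0" and k=0])
      (use norm[unfolded \<rho>_def] power r L D in \<open>auto simp: \<kappa>_def dker_pos integral_ln_dker\<close>)
  moreover have "(\<Sum>c\<in>C. \<Sum>a\<in>A. \<Sum>b\<in>B. \<integral>z. ln (\<kappa> c a (offset n (\<lambda>t. u c a t + w c b t) (\<lambda>_. 0) z)) \<partial>noise n)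
           / (card C * card A * card B) = - ln r - ln 2 - ln L * err n C A B u w D"
    using cp r L D by (simp add: \<kappa>_def integral_ln_dker err_def sum_subtractf diff_divide_distrib
        sum_distrib_left[symmetric])
  moreover have "ln L = ln (card C * card A) - ln r"
    using cp r unfolding L_def by (subst ln_div) auto
  moreover have "(1 - err n C A B u w D) * ln L = ln L - ln L * err n C A B u w D"
    by (simp add: algebra_simps)
  ultimately show ?thesis
    unfolding L_def[symmetric] by linarith
qed

section \<open>Centring of signals and degenerate mixtures\<close>

lemma sum_cmod_square_centred:
  fixes p :: "'a \<Rightarrow> complex" and q :: "'b \<Rightarrow> complex"
  assumes "(\<Sum>a\<in>A. p a) = 0"
  shows "(\<Sum>a\<in>A. \<Sum>b\<in>B. (cmod (p a + q b))\<^sup>2) = card B * (\<Sum>a\<in>A. (cmod (p a))\<^sup>2) + card A * (\<Sum>b\<in>B. (cmod (q b))\<^sup>2)"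
proof -
  have "(\<Sum>a\<in>A. \<Sum>b\<in>B. (cmod (p a + q b))\<^sup>2)
     = (\<Sum>a\<in>A. \<Sum>b\<in>B. (cmod (p a))\<^sup>2 + (cmod (q b))\<^sup>2 + 2 * Re (p a * cnj (q b)))"
    by (intro sum.cong refl) (simp only: cmod_power2, simp add: power2_eq_square algebra_simps)
  \<comment> \<open>The cross terms factor into a product of two sums, one of which
    vanishes.\<close>
  also have "\<dots> = card B * (\<Sum>a\<in>A. (cmod (p a))\<^sup>2) + card A * (\<Sum>b\<in>B. (cmod (q b))\<^sup>2)
      + 2 * Re ((\<Sum>a\<in>A. p a) * (\<Sum>b\<in>B. cnj (q b)))"
    unfolding sum_product Re_sum by (simp add: sum.distrib sum_distrib_left)
  finally show ?thesis using assms by simp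
qed

definition avg :: "'a set \<Rightarrow> ('a \<Rightarrow> complex) \<Rightarrow> complex" where
  "avg A x = (\<Sum>a\<in>A. x a) / of_nat (card A)"

lemma sum_minus_avg:
  assumes "finite A"
  shows "(\<Sum>a\<in>A. x a - avg A x) = 0"
  using assms by (cases "A = {}") (auto simp: avg_def sum_subtractf)

lemma sum_cmod_square_minus_avg_le:
  assumes "finite A"
  shows "(\<Sum>a\<in>A. (cmod (x a - avg A x))\<^sup>2) \<le> (\<Sum>a\<in>A. (cmod (x a))\<^sup>2)"
  using sum_cmod_square_centred[OF sum_minus_avg[OF assms, of x], where B="{()}" and q="\<lambda>_. avg A x"]
  by simp

lemma mix_const:
  assumes "finite A" "A \<noteq> {}"
  shows "mix n A (\<lambda>_. v) (\<lambda>t. v t + x t) = Phi n x"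
  using assms by (simp add: mix_def)

lemma hmix_const:
  assumes "finite C" "C \<noteq> {}" "finite A" "A \<noteq> {}"
  shows "hmix n C A (\<lambda>c _. v c) = n * (ln pi + 1)"
  using assms by (simp add: hmix_def mix_const integral_ln_Phi divide_simps)

text \<open>A one-letter alphabet makes the interference a function of \<open>c\<close>, leaving
  only the noise entropy. This models a revealed private message.\<close>

lemma hmix_unit:
  assumes "finite C" "C \<noteq> {}"
  shows "hmix n C {()} w = n * (ln pi + 1)"
  using hmix_const[OF assms, of "{()}" n "\<lambda>c. w c ()"] by (simp add: hmix_def)

text \<open>A further condition that does not enter the signal only repeats every term
  \<open>card B\<close> times.\<close>

lemma hmix_Times:
  fixes C :: "'c set"
  assumes "finite B" "B \<noteq> {}"
  shows "hmix n (C \<times> B) A (\<lambda>p. v (fst p)) = hmix n C A v"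
proof -
  have "(\<Sum>p\<in>C \<times> B. F (fst p)) = card B * (\<Sum>c\<in>C. F c)" for F :: "'c \<Rightarrow> real"
    using sum.cartesian_product[of "\<lambda>c b. F c" B C] by (simp add: case_prod_beta' sum_distrib_left)
  from this[of "\<lambda>c. \<Sum>a\<in>A. \<integral>z. ln (mix n A (v c) (\<lambda>t. v c a t + fst (z t))) \<partial>noise n"]
  show ?thesis
    using assms by (simp add: hmix_def card_cartesian_product mult.assoc)
qed

text \<open>At unit power, estimating h X from g X + Z2 has minimum mean square error |h|^2/(1 +
  |g|^2), and \<open>p\<close> bounds the variance of the interference given \<open>c\<close>. Given
  \<open>c\<close> the two signals are independent, so after centring their powers add without a
  cross term.\<close>

lemma private_message_genie_bound:
  fixes x :: "'c \<Rightarrow> 'a \<Rightarrow> nat \<Rightarrow> complex" and w :: "'c \<Rightarrow> 'b \<Rightarrow> nat \<Rightarrow> complex" and h g :: complex and p :: real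
  assumes C: "finite C" "C \<noteq> {}" and A: "finite A" "A \<noteq> {}" and B: "finite B" "B \<noteq> {}"
    and D: "\<And>c a. Measurable.pred (outspace n) (D c a)"
    and D1: "\<And>c a a' y. D c a y \<Longrightarrow> D c a' y \<Longrightarrow> a = a'"
    and x: "(\<Sum>c\<in>C. \<Sum>a\<in>A. \<Sum>t<n. (cmod (x c a t))\<^sup>2) \<le> card C * card A * n"
    and w: "(\<Sum>c\<in>C. \<Sum>b\<in>B. \<Sum>t<n. (cmod (w c b t - avg B (\<lambda>b. w c b t)))\<^sup>2) \<le> card C * card B * n * p"
    and p: "p \<ge> 0"
  shows "(1 - err n C A B (\<lambda>c a t. h * x c a t) w D) * ln (card A)
    \<le> ln 2 + n * ln (1 + (p + (cmod h)\<^sup>2 / (1 + (cmod g)\<^sup>2))) + hmix n C A (\<lambda>c a t. g * x c a t) - hmix n C B w"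
proof -
  define s where "s = 1 + (cmod g)\<^sup>2"
  have s: "s > 0" by (simp add: s_def add_pos_nonneg)
  have sc: "complex_of_real s = 1 + g * cnj g" by (simp only: s_def of_real_add of_real_1 complex_norm_square)
  \<comment> \<open>Linear minimum mean square error coefficient for estimating \<open>h X + Z1\<close> from \<open>g X + Z2\<close>.\<close>
  define k where "k = h * cnj g / s"
  define q where "q = h - k * g"
  have q: "q = h / s"
  proof -
    have "q * s = h * (s - g * cnj g)"
      unfolding q_def k_def using s by (simp add: algebra_simps)
    then have "q * s = h" by (simp add: sc)
    then show ?thesis using s by (simp add: eq_divide_eq)
  qed
  \<comment> \<open>In the residual \<open>q\<close> multiplies the own signal and \<open>-k\<close>
    the second noise, so the sum of squares is the minimum mean square error.\<close>
  have qk: "(cmod q)\<^sup>2 + (cmod k)\<^sup>2 = (cmod h)\<^sup>2 / (1 + (cmod g)\<^sup>2)"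
  proof -
    have "(cmod q)\<^sup>2 + (cmod k)\<^sup>2 = (cmod h)\<^sup>2 * (1 + (cmod g)\<^sup>2) / s\<^sup>2"
      using s by (simp add: q k_def norm_divide norm_mult power_divide power_mult_distrib add_divide_distrib algebra_simps)
    then show ?thesis using s unfolding s_def[symmetric] by (simp add: power2_eq_square)
  qed
  \<comment> \<open>Codewords need not have mean zero given \<open>c\<close>; this offset subtracts
    both conditional means.\<close>
  define m where "m c t = q * avg A (\<lambda>a. x c a t) + avg B (\<lambda>b. w c b t)" for c t
  have split: "h * x c a t + w c b t - m c t - k * (g * x c a t)
      = q * (x c a t - avg A (\<lambda>a. x c a t)) + (w c b t - avg B (\<lambda>b. w c b t))" for c a b t
    by (simp add: m_def q_def algebra_simps)
  have "(\<Sum>c\<in>C. \<Sum>a\<in>A. \<Sum>b\<in>B. \<Sum>t<n. (cmod (h * x c a t + w c b t - m c t - k * (g * x c a t)))\<^sup>2)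
      = (\<Sum>c\<in>C. \<Sum>t<n. \<Sum>a\<in>A. \<Sum>b\<in>B. (cmod (q * (x c a t - avg A (\<lambda>a. x c a t)) + (w c b t - avg B (\<lambda>b. w c b t))))\<^sup>2)"
    unfolding split by (simp only: sum.swap[of _ _ "{..<n}"])
  also have "\<dots> = (\<Sum>c\<in>C. \<Sum>t<n. card B * (\<Sum>a\<in>A. (cmod (q * (x c a t - avg A (\<lambda>a. x c a t))))\<^sup>2)
      + card A * (\<Sum>b\<in>B. (cmod (w c b t - avg B (\<lambda>b. w c b t)))\<^sup>2))"
    by (intro sum.cong refl sum_cmod_square_centred)
      (simp add: sum_distrib_left[symmetric] sum_minus_avg A)
  also have "\<dots> \<le> (\<Sum>c\<in>C. \<Sum>t<n. card B * ((cmod q)\<^sup>2 * (\<Sum>a\<in>A. (cmod (x c a t))\<^sup>2))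
      + card A * (\<Sum>b\<in>B. (cmod (w c b t - avg B (\<lambda>b. w c b t)))\<^sup>2))"
    unfolding norm_mult power_mult_distrib sum_distrib_left[symmetric]
    by (intro sum_mono add_right_mono mult_left_mono sum_cmod_square_minus_avg_le A) auto
  also have "\<dots> = card B * ((cmod q)\<^sup>2 * (\<Sum>c\<in>C. \<Sum>a\<in>A. \<Sum>t<n. (cmod (x c a t))\<^sup>2))
      + card A * (\<Sum>c\<in>C. \<Sum>b\<in>B. \<Sum>t<n. (cmod (w c b t - avg B (\<lambda>b. w c b t)))\<^sup>2)"
    by (simp only: sum.distrib sum_distrib_left[symmetric] sum.swap[of _ _ "{..<n}"])
  also have "\<dots> \<le> card B * ((cmod q)\<^sup>2 * (card C * card A * n)) + card A * (card C * card B * n * p)"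
    by (intro add_mono mult_left_mono x w) auto
  also have "\<dots> = card C * card A * card B * (n * ((1 + (p + (cmod h)\<^sup>2 / (1 + (cmod g)\<^sup>2))) - 1 - (cmod k)\<^sup>2))"
    unfolding qk[symmetric] by (simp add: algebra_simps)
  finally have power: "(\<Sum>c\<in>C. \<Sum>a\<in>A. \<Sum>b\<in>B. \<Sum>t<n. (cmod (h * x c a t + w c b t - m c t - k * (g * x c a t)))\<^sup>2)
     \<le> card C * card A * card B * (n * ((1 + (p + (cmod h)\<^sup>2 / (1 + (cmod g)\<^sup>2))) - 1 - (cmod k)\<^sup>2))" .
  show ?thesis
    by (rule private_message_bound[OF C A B _ D D1 power]) (use p in \<open>auto intro!: add_pos_nonneg\<close>)
qed

section \<open>Revealing the other private message, and the bounds at one receiver\<close>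

lemma sum_Times_swap:
  fixes F :: "'c \<Rightarrow> 'a \<Rightarrow> 'b \<Rightarrow> real"
  shows "(\<Sum>q\<in>C \<times> B. \<Sum>a\<in>A. F (fst q) a (snd q)) = (\<Sum>c\<in>C. \<Sum>a\<in>A. \<Sum>b\<in>B. F c a b)"
proof -
  have "(\<Sum>q\<in>C \<times> B. \<Sum>a\<in>A. F (fst q) a (snd q)) = (\<Sum>c\<in>C. \<Sum>b\<in>B. \<Sum>a\<in>A. F c a b)"
    using sum.cartesian_product[of "\<lambda>c b. \<Sum>a\<in>A. F c a b" B C] by (simp add: case_prod_beta')
  also have "\<dots> = (\<Sum>c\<in>C. \<Sum>a\<in>A. \<Sum>b\<in>B. F c a b)"
    by (intro sum.cong refl sum.swap)
  finally show ?thesis .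
qed

text \<open>Moving \<open>b\<close> from the interference alphabet into the condition changes no
  error event, because the test \<open>D\<close> does not look at \<open>b\<close>.\<close>

lemma err_Times:
  "err n (C \<times> B) A {()} (\<lambda>q. u (fst q)) (\<lambda>q _. w (fst q) (snd q)) (\<lambda>q. D (fst q)) = err n C A B u w D"
  unfolding err_def
  using sum_Times_swap[where C=C and B=B and A=A and F="\<lambda>c a b. measure (noise n)
    {z \<in> space (noise n). \<not> D c a (\<lambda>t\<in>{..<n}. u c a t + w c b t + fst (z t))}"]
  by (simp add: card_cartesian_product mult_ac)

text \<open>\<open>A\<close> holds the private messages of this receiver and \<open>B\<close> those
  of the other; \<open>h\<close> is the direct gain and \<open>j\<close> the gain of the interfering
  transmitter. The gain \<open>g\<close> of the side information stays free in the bounds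
  below.\<close>

locale receiver =
  fixes n :: nat and C :: "'c set" and A :: "'a set" and B :: "'b set"
    and x1 :: "'c \<Rightarrow> 'a \<Rightarrow> nat \<Rightarrow> complex" and x2 :: "'c \<Rightarrow> 'b \<Rightarrow> nat \<Rightarrow> complex"
    and dec :: "(nat \<Rightarrow> complex) \<Rightarrow> 'c \<times> 'a" and h j :: complex
  assumes C: "finite C" "C \<noteq> {}" and A: "finite A" "A \<noteq> {}" and B: "finite B" "B \<noteq> {}"
    and dec: "dec \<in> measurable (outspace n) (count_space UNIV)"
    and power1: "(\<Sum>c\<in>C. \<Sum>a\<in>A. \<Sum>t<n. (cmod (x1 c a t))\<^sup>2) \<le> card C * card A * n"
    and power2: "(\<Sum>c\<in>C. \<Sum>b\<in>B. \<Sum>t<n. (cmod (x2 c b t))\<^sup>2) \<le> card C * card B * n"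
begin

definition eps :: real where
  "eps = err n C A B (\<lambda>c a t. h * x1 c a t) (\<lambda>c b t. j * x2 c b t) (\<lambda>c a y. dec y = (c, a))"

lemma dec_pred [measurable]: "Measurable.pred (outspace n) (\<lambda>y. dec y = (c, a))"
  using dec by measurable

text \<open>Centring does not increase power, so the interference has variance at most |j|^2. Taking
  for \<open>g\<close> the gain towards the other receiver yields the terms \<open>E1\<close>,
  \<open>E2\<close>; taking 0 yields \<open>G1\<close>, \<open>G2\<close>.\<close>

lemma interference_limited_bound:
  "(1 - eps) * ln (card A) \<le> ln 2 + n * ln (1 + ((cmod j)\<^sup>2 + (cmod h)\<^sup>2 / (1 + (cmod g)\<^sup>2)))
     + hmix n C A (\<lambda>c a t. g * x1 c a t) - hmix n C B (\<lambda>c b t. j * x2 c b t)"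
  unfolding eps_def
proof (rule private_message_genie_bound[OF C A B])
  have "(\<Sum>c\<in>C. \<Sum>b\<in>B. \<Sum>t<n. (cmod (j * x2 c b t - avg B (\<lambda>b. j * x2 c b t)))\<^sup>2)
     = (\<Sum>c\<in>C. \<Sum>t<n. \<Sum>b\<in>B. (cmod (j * x2 c b t - avg B (\<lambda>b. j * x2 c b t)))\<^sup>2)"
    by (simp only: sum.swap[of _ _ "{..<n}"])
  also have "\<dots> \<le> (\<Sum>c\<in>C. \<Sum>t<n. \<Sum>b\<in>B. (cmod (j * x2 c b t))\<^sup>2)"
    by (intro sum_mono sum_cmod_square_minus_avg_le B)
  also have "\<dots> = (cmod j)\<^sup>2 * (\<Sum>c\<in>C. \<Sum>b\<in>B. \<Sum>t<n. (cmod (x2 c b t))\<^sup>2)"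
    by (simp only: sum.swap[of _ _ "{..<n}"] norm_mult power_mult_distrib sum_distrib_left[symmetric])
  also have "\<dots> \<le> (cmod j)\<^sup>2 * (card C * card B * n)"
    by (intro mult_left_mono power2) auto
  finally show "(\<Sum>c\<in>C. \<Sum>b\<in>B. \<Sum>t<n. (cmod (j * x2 c b t - avg B (\<lambda>b. j * x2 c b t)))\<^sup>2)
     \<le> card C * card B * n * (cmod j)\<^sup>2" by (simp add: mult_ac)
qed (use power1 in auto)

text \<open>Once \<open>b\<close> joins the condition, the interference has variance 0 and
  contributes only noise entropy. The two choices of \<open>g\<close> now yield \<open>A1\<close>,
  \<open>A2\<close> and \<open>D1\<close>, \<open>D2\<close>.\<close>

lemma interference_free_bound:
  "(1 - eps) * ln (card A) \<le> ln 2 + n * ln (1 + (cmod h)\<^sup>2 / (1 + (cmod g)\<^sup>2))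
     + hmix n C A (\<lambda>c a t. g * x1 c a t) - n * (ln pi + 1)"
proof -
  have CB: "finite (C \<times> B)" "C \<times> B \<noteq> {}" using B C by auto
  have U: "finite {()}" "{()} \<noteq> {}" by auto
  have x: "(\<Sum>q\<in>C \<times> B. \<Sum>a\<in>A. \<Sum>t<n. (cmod (x1 (fst q) a t))\<^sup>2) \<le> card (C \<times> B) * card A * n"
  proof -
    have "(\<Sum>q\<in>C \<times> B. \<Sum>a\<in>A. \<Sum>t<n. (cmod (x1 (fst q) a t))\<^sup>2)
        = card B * (\<Sum>c\<in>C. \<Sum>a\<in>A. \<Sum>t<n. (cmod (x1 c a t))\<^sup>2)"
      by (subst sum_Times_swap[where F="\<lambda>c a b. \<Sum>t<n. (cmod (x1 c a t))\<^sup>2"]) (simp add: sum_distrib_left)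
    also have "\<dots> \<le> card B * real (card C * card A * n)"
      by (intro mult_left_mono power1) auto
    finally show ?thesis by (simp add: card_cartesian_product mult_ac)
  qed
  have "(1 - err n (C \<times> B) A {()} (\<lambda>q a t. h * x1 (fst q) a t) (\<lambda>q _ t. j * x2 (fst q) (snd q) t)
        (\<lambda>q a y. dec y = (fst q, a))) * ln (card A)
      \<le> ln 2 + n * ln (1 + (0 + (cmod h)\<^sup>2 / (1 + (cmod g)\<^sup>2))) + hmix n (C \<times> B) A (\<lambda>q a t. g * x1 (fst q) a t)
         - hmix n (C \<times> B) {()} (\<lambda>q _ t. j * x2 (fst q) (snd q) t)"
    by (rule private_message_genie_bound[OF CB A U _ _ x]) (auto simp: avg_def)
  then show ?thesis
    using hmix_Times[OF B, of n C A "\<lambda>c a t. g * x1 c a t"]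
      err_Times[of n C B A "\<lambda>c a t. h * x1 c a t" "\<lambda>c b t. j * x2 c b t" "\<lambda>c a y. dec y = (c, a)"]
    by (simp add: eps_def hmix_unit[OF CB])
qed

text \<open>The common message can correlate the inputs, so amplitudes add. Cauchy-Schwarz with
  weights \<open>cmod h\<close> and \<open>cmod j\<close> gives a pointwise bound linear in the two
  input powers, which can be averaged.\<close>

lemma total_power:
  "(\<Sum>c\<in>C. \<Sum>a\<in>A. \<Sum>b\<in>B. \<Sum>t<n. (cmod (h * x1 c a t + j * x2 c b t))\<^sup>2)
     \<le> card C * card A * card B * (n * (cmod h + cmod j)\<^sup>2)"
proof -
  define \<alpha> \<beta> where "\<alpha> = cmod h" and "\<beta> = cmod j"
  have ab: "\<alpha> \<ge> 0" "\<beta> \<ge> 0" by (auto simp: \<alpha>_def \<beta>_def)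
  have pt: "(cmod (h * x + j * y))\<^sup>2 \<le> (\<alpha> + \<beta>) * (\<alpha> * (cmod x)\<^sup>2 + \<beta> * (cmod y)\<^sup>2)" for x y
  proof -
    have "(cmod (h * x + j * y))\<^sup>2 \<le> (\<alpha> * cmod x + \<beta> * cmod y)\<^sup>2"
      by (intro power_mono norm_triangle_le) (auto simp: norm_mult \<alpha>_def \<beta>_def)
    also have "\<dots> = (\<alpha> + \<beta>) * (\<alpha> * (cmod x)\<^sup>2 + \<beta> * (cmod y)\<^sup>2) - \<alpha> * \<beta> * (cmod x - cmod y)\<^sup>2"
      by (simp add: power2_eq_square algebra_simps)
    finally show ?thesis using ab by (smt (verit) mult_nonneg_nonneg zero_le_power2)
  qed
  have "(\<Sum>c\<in>C. \<Sum>a\<in>A. \<Sum>b\<in>B. \<Sum>t<n. (cmod (h * x1 c a t + j * x2 c b t))\<^sup>2)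
      \<le> (\<Sum>c\<in>C. \<Sum>a\<in>A. \<Sum>b\<in>B. \<Sum>t<n. (\<alpha> + \<beta>) * (\<alpha> * (cmod (x1 c a t))\<^sup>2 + \<beta> * (cmod (x2 c b t))\<^sup>2))"
    by (intro sum_mono pt)
  also have "\<dots> = (\<alpha> + \<beta>) * (\<alpha> * (card B * (\<Sum>c\<in>C. \<Sum>a\<in>A. \<Sum>t<n. (cmod (x1 c a t))\<^sup>2))
      + \<beta> * (card A * (\<Sum>c\<in>C. \<Sum>b\<in>B. \<Sum>t<n. (cmod (x2 c b t))\<^sup>2)))"
    by (simp add: sum_distrib_left[symmetric] sum.distrib)
  also have "\<dots> \<le> (\<alpha> + \<beta>) * (\<alpha> * (card B * real (card C * card A * n)) + \<beta> * (card A * real (card C * card B * n)))"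
    using ab by (intro mult_left_mono add_mono power1 power2) auto
  also have "\<dots> = card C * card A * card B * (n * (\<alpha> + \<beta>)\<^sup>2)"
    by (simp add: power2_eq_square algebra_simps)
  finally show ?thesis by (simp add: \<alpha>_def \<beta>_def)
qed

lemma common_message_bound:
  "(1 - eps) * ln (card C * card A) \<le> ln 2 + n * ln (1 + (cmod h + cmod j)\<^sup>2) + n * (ln pi + 1)
     - hmix n C B (\<lambda>c b t. j * x2 c b t)"
proof -
  have "(1 - eps) * ln (card C * card A / 1) \<le> ln 2 + n * ln (1 + (cmod h + cmod j)\<^sup>2)
      + hmix n C A (\<lambda>_ _ _. 0) - hmix n C B (\<lambda>c b t. j * x2 c b t)"
    unfolding eps_def
  proof (rule joint_message_bound[OF C A B])
    fix y
    have "{p \<in> C \<times> A. dec y = (fst p, snd p)} \<subseteq> {dec y}" by auto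
    from card_mono[OF _ this] show "real (card {p \<in> C \<times> A. dec y = (fst p, snd p)}) \<le> 1" by simp
  qed (use total_power in \<open>auto intro!: add_pos_nonneg\<close>)
  then show ?thesis using hmix_const[OF C A, of n "\<lambda>_ _. 0"] by simp
qed

text \<open>Revealing \<open>b\<close> turns the interference entropy into noise entropy, which
  cancels that of the zero side information.\<close>

lemma common_message_interference_free_bound:
  "(1 - eps) * ln (card C * card A) \<le> ln 2 + n * ln (1 + (cmod h + cmod j)\<^sup>2)"
proof -
  have CB: "finite (C \<times> B)" "C \<times> B \<noteq> {}" using B C by auto
  have U: "finite {()}" "{()} \<noteq> {}" by auto
  have cB: "real (card B) > 0" using B by (simp add: card_gt_0_iff)
  have "(1 - err n (C \<times> B) A {()} (\<lambda>q a t. h * x1 (fst q) a t) (\<lambda>q _ t. j * x2 (fst q) (snd q) t)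
        (\<lambda>q a y. dec y = (fst q, a))) * ln (card (C \<times> B) * card A / card B)
      \<le> ln 2 + n * ln (1 + (cmod h + cmod j)\<^sup>2) + hmix n (C \<times> B) A (\<lambda>_ _ _. 0)
         - hmix n (C \<times> B) {()} (\<lambda>q _ t. j * x2 (fst q) (snd q) t)"
  proof (rule joint_message_bound[OF CB A U])
    fix y
    \<comment> \<open>The decoder does not report \<open>b\<close>, so up to \<open>card B\<close>
      triples match one output. This is the value of \<open>r\<close>, and it cancels
      \<open>card B\<close> in the number of triples.\<close>
    have "{p \<in> (C \<times> B) \<times> A. dec y = (fst (fst p), snd p)} \<subseteq> (\<lambda>b. ((fst (dec y), b), snd (dec y))) ` B"
      by (auto simp: image_iff)
    from card_mono[OF _ this] card_image_le[OF B(1)] B(1)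
    show "real (card {p \<in> (C \<times> B) \<times> A. dec y = (fst (fst p), snd p)}) \<le> card B"
      by (meson finite_imageI of_nat_mono order_trans)
    show "(\<Sum>q\<in>C \<times> B. \<Sum>a\<in>A. \<Sum>b\<in>{()}. \<Sum>t<n. (cmod (h * x1 (fst q) a t + j * x2 (fst q) (snd q) t))\<^sup>2)
      \<le> card (C \<times> B) * card A * card {()} * (n * (1 + (cmod h + cmod j)\<^sup>2 - 1))"
      using total_power
        sum_Times_swap[where C=C and A=A and B=B and F="\<lambda>c a b. \<Sum>t<n. (cmod (h * x1 c a t + j * x2 c b t))\<^sup>2"]
      by (simp add: card_cartesian_product mult_ac)
  qed (use cB in \<open>auto intro!: add_pos_nonneg\<close>)
  then show ?thesis
    using cB err_Times[of n C B A "\<lambda>c a t. h * x1 c a t" "\<lambda>c b t. j * x2 c b t" "\<lambda>c a y. dec y = (c, a)"]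
      hmix_const[OF CB A, of n "\<lambda>_ _. 0"]
    by (simp add: eps_def hmix_unit[OF CB] card_cartesian_product)
qed

end

subsection \<open>The outer region\<close>

text \<open>\<open>\<eta>\<close> and \<open>\<eta>'\<close> are entropies above the noise level, in
  bits: of the side information and of the interference suffered. The constant 1 is
  \<open>ln 2\<close> nats, and \<open>e \<le> 1\<close> keeps \<open>1 - e\<close> nonnegative when
  message counts are replaced by rates.\<close>

lemma (in receiver) rate_bounds:
  fixes R0 R1 e :: real and g :: complex
  assumes e: "eps \<le> e" "e \<le> 1"
    and R0: "n * R0 * ln 2 \<le> ln (card C)" and R1: "n * R1 * ln 2 \<le> ln (card A)"
  defines "\<eta> \<equiv> (hmix n C A (\<lambda>c a t. g * x1 c a t) - n * (ln pi + 1)) / ln 2"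
    and "\<eta>' \<equiv> (hmix n C B (\<lambda>c b t. j * x2 c b t) - n * (ln pi + 1)) / ln 2"
  shows "(1 - e) * (n * R1) \<le> 1 + n * Cap ((cmod j)\<^sup>2 + (cmod h)\<^sup>2 / (1 + (cmod g)\<^sup>2)) + \<eta> - \<eta>'"
    and "(1 - e) * (n * R1) \<le> 1 + n * Cap ((cmod h)\<^sup>2 + (cmod j)\<^sup>2) - \<eta>'"
    and "(1 - e) * (n * R1) \<le> 1 + n * Cap ((cmod h)\<^sup>2 / (1 + (cmod g)\<^sup>2)) + \<eta>"
    and "(1 - e) * (n * R1) \<le> 1 + n * Cap ((cmod h)\<^sup>2)"
    and "(1 - e) * (n * R0) + (1 - e) * (n * R1) \<le> 1 + n * Cap ((cmod h + cmod j)\<^sup>2) - \<eta>'"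
    and "(1 - e) * (n * R0) + (1 - e) * (n * R1) \<le> 1 + n * Cap ((cmod h + cmod j)\<^sup>2)"
proof -
  have cp: "card C \<ge> 1" "card A \<ge> 1" using A C by (simp_all add: Suc_le_eq card_gt_0_iff)
  have l2: "ln 2 > (0::real)" by simp
  have step: "(1 - e) * X \<le> Y / ln 2"
    if "(1 - eps) * L \<le> Y" "X * ln 2 \<le> L" "0 \<le> L" for X Y L :: real
  proof -
    have "((1 - e) * X) * ln 2 = (1 - e) * (X * ln 2)" by simp
    also have "\<dots> \<le> (1 - e) * L" using that e by (intro mult_left_mono) auto
    also have "\<dots> \<le> (1 - eps) * L" using that e by (intro mult_right_mono) auto
    finally show ?thesis using that(1) l2 by (simp add: pos_le_divide_eq)
  qed
  have "ln (card C * card A) = ln (card C) + ln (card A)"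
    using cp by (simp add: ln_mult)
  then have R01: "(n * R0 + n * R1) * ln 2 \<le> ln (card C * card A)"
    using R0 R1 by (simp add: algebra_simps)
  have nn: "0 \<le> ln (card A)" "0 \<le> ln (card C * card A)"
    using cp by (auto simp: ln_ge_zero Suc_le_eq simp flip: of_nat_mult)
  have zero: "hmix n C A (\<lambda>_ _ _. 0) = n * (ln pi + 1)"
    using hmix_const[OF C A, of n "\<lambda>_ _. 0"] .
  note defs = \<eta>_def \<eta>'_def Cap_def log_def diff_divide_distrib add_divide_distrib
  show "(1 - e) * (n * R1) \<le> 1 + n * Cap ((cmod j)\<^sup>2 + (cmod h)\<^sup>2 / (1 + (cmod g)\<^sup>2)) + \<eta> - \<eta>'"
    using step[OF interference_limited_bound[of g] R1 nn(1)] by (simp add: defs)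
  show "(1 - e) * (n * R1) \<le> 1 + n * Cap ((cmod h)\<^sup>2 + (cmod j)\<^sup>2) - \<eta>'"
    using step[OF interference_limited_bound[of 0] R1 nn(1)] by (simp add: defs zero add.commute)
  show "(1 - e) * (n * R1) \<le> 1 + n * Cap ((cmod h)\<^sup>2 / (1 + (cmod g)\<^sup>2)) + \<eta>"
    using step[OF interference_free_bound[of g] R1 nn(1)] by (simp add: defs)
  show "(1 - e) * (n * R1) \<le> 1 + n * Cap ((cmod h)\<^sup>2)"
    using step[OF interference_free_bound[of 0] R1 nn(1)] by (simp add: defs zero)
  show "(1 - e) * (n * R0) + (1 - e) * (n * R1) \<le> 1 + n * Cap ((cmod h + cmod j)\<^sup>2) - \<eta>'"
    using step[OF common_message_bound R01 nn(2)] by (simp add: defs algebra_simps)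
  show "(1 - e) * (n * R0) + (1 - e) * (n * R1) \<le> 1 + n * Cap ((cmod h + cmod j)\<^sup>2)"
    using step[OF common_message_interference_free_bound R01 nn(2)] by (simp add: defs algebra_simps)
qed

section \<open>From codes to rates, and the limit of long blocks\<close>

lemma msize_ge: "2 powr (n * R) \<le> msize n R"
  unfolding msize_def by linarith

lemma msize_pos: "msize n R > 0"
  using msize_ge[of n R] powr_gt_zero[of 2 "n * R"] by linarith

lemma ln_msize_ge: "n * R * ln 2 \<le> ln (msize n R)"
proof -
  have "ln (2 powr (n * R)) \<le> ln (msize n R)"
    using msize_ge msize_pos by (subst ln_le_cancel_iff) auto
  then show ?thesis by (simp add: ln_powr)
qed

lemma measure_noise_swap:
  assumes [measurable]: "Measurable.pred (noise n) Q"
  shows "measure (noise n) {z \<in> space (noise n). Q (\<lambda>t\<in>{..<n}. prod.swap (z t))}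
     = measure (noise n) {z \<in> space (noise n). Q z}"
proof -
  let ?T = "\<lambda>z. \<lambda>t\<in>{..<n}. prod.swap (z t)"
  have [measurable]: "?T \<in> measurable (noise n) (noise n)"
    unfolding noise_def by (rule measurable_restrict) (auto simp: prod.swap_def[abs_def])
  have "measure (noise n) {z \<in> space (noise n). Q z} = measure (distr (noise n) (noise n) ?T) {z \<in> space (noise n). Q z}"
    by (simp only: distr_noise_swap)
  also have "\<dots> = measure (noise n) (?T -` {z \<in> space (noise n). Q z} \<inter> space (noise n))"
    by (rule measure_distr) measurable
  also have "?T -` {z \<in> space (noise n). Q z} \<inter> space (noise n) = {z \<in> space (noise n). Q (?T z)}"
    using measurable_space[OF \<open>?T \<in> measurable (noise n) (noise n)\<close>] by auto
  finally show ?thesis by simp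
qed

lemma power_constraint_sum:
  fixes f :: "nat \<Rightarrow> nat \<Rightarrow> nat \<Rightarrow> complex"
  assumes "(1 / real n) * (\<Sum>t<n. (\<Sum>m\<in>{1..M}. \<Sum>k\<in>{1..K}. (cmod (f m k t))\<^sup>2) / real (M * K)) \<le> 1"
    and "n > 0" "M > 0" "K > 0"
  shows "(\<Sum>m\<in>{1..M}. \<Sum>k\<in>{1..K}. \<Sum>t<n. (cmod (f m k t))\<^sup>2) \<le> card {1..M} * card {1..K} * n"
proof -
  have "(\<Sum>m\<in>{1..M}. \<Sum>k\<in>{1..K}. \<Sum>t<n. (cmod (f m k t))\<^sup>2)
     = (\<Sum>t<n. \<Sum>m\<in>{1..M}. \<Sum>k\<in>{1..K}. (cmod (f m k t))\<^sup>2)"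
    by (simp only: sum.swap[of _ _ "{..<n}"])
  moreover have "(\<Sum>t<n. \<Sum>m\<in>{1..M}. \<Sum>k\<in>{1..K}. (cmod (f m k t))\<^sup>2) / real (M * K) \<le> n"
    using assms by (simp add: sum_divide_distrib[symmetric] field_simps)
  ultimately show ?thesis
    using assms by (simp add: pos_divide_le_eq mult_ac)
qed

text \<open>At most three bounds of one receiver are added for an inequality of the region, each
  with loss 1; hence the 3, which vanishes after division by \<open>n\<close>.\<close>

lemma rate_limit:
  fixes e :: "nat \<Rightarrow> real" and X Y :: real
  assumes e: "e \<longlonglongrightarrow> 0"
    and le: "\<And>n. n > 0 \<Longrightarrow> e n \<le> 1 \<Longrightarrow> (1 - e n) * (n * X) \<le> 3 + n * Y"
  shows "X \<le> Y"
proof (rule tendsto_le[OF sequentially_bot])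
  have "(\<lambda>n. 3 * inverse (real n) + Y) \<longlonglongrightarrow> 3 * 0 + Y"
    by (intro tendsto_intros lim_inverse_n)
  then show "(\<lambda>n. 3 * inverse (real n) + Y) \<longlonglongrightarrow> Y" by simp
  have "(\<lambda>n. (1 - e n) * X) \<longlonglongrightarrow> (1 - 0) * X" by (intro tendsto_intros e)
  then show "(\<lambda>n. (1 - e n) * X) \<longlonglongrightarrow> X" by simp
  have "eventually (\<lambda>n. e n < 1) sequentially" using e by (rule order_tendstoD) simp
  then show "eventually (\<lambda>n. (1 - e n) * X \<le> 3 * inverse (real n) + Y) sequentially"
    using eventually_gt_at_top[of 0]
  proof eventually_elim
    case (elim n)
    then have "(1 - e n) * (n * X) \<le> 3 + n * Y" by (intro le) auto
    then have "n * ((1 - e n) * X) \<le> n * (3 * inverse (real n) + Y)"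
      using elim by (simp add: distrib_left mult.left_commute[of _ 3] mult.left_commute[of "real n" "1 - e n"])
    then show ?case using elim by simp
  qed
qed

lemma closed_outer_region: "closed (outer_region h11 h12 h21 h22)"
  unfolding outer_region_def Let_def case_prod_beta'
  by (intro closed_Collect_conj closed_Collect_le continuous_intros)

lemma achievable_outer_region:
  assumes "achievable h11 h12 h21 h22 (R0, R1, R2)"
  shows "(R0, R1, R2) \<in> outer_region h11 h12 h21 h22"
proof -
  obtain f1 f2 g1 g2 where nonneg: "R0 \<ge> 0" "R1 \<ge> 0" "R2 \<ge> 0"
    and code: "\<And>n. is_code n R0 R1 R2 (f1 n) (f2 n) (g1 n) (g2 n)"
    and lim: "(\<lambda>n. err_prob h11 h12 h21 h22 n R0 R1 R2 (f1 n) (f2 n) (g1 n) (g2 n)) \<longlonglongrightarrow> 0"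
    using assms unfolding achievable_def by auto
  define e where "e n = err_prob h11 h12 h21 h22 n R0 R1 R2 (f1 n) (f2 n) (g1 n) (g2 n)" for n
  define a11 a12 a21 a22 where "a11 = (cmod h11)\<^sup>2" and "a12 = (cmod h12)\<^sup>2"
    and "a21 = (cmod h21)\<^sup>2" and "a22 = (cmod h22)\<^sup>2"
  define r0 r1 r2 where "r0 n = (1 - e n) * (n * R0)" and "r1 n = (1 - e n) * (n * R1)"
    and "r2 n = (1 - e n) * (n * R2)" for n
  \<comment> \<open>\<open>\<eta>1\<close> belongs to the interference from transmitter 1 at
    receiver 2, \<open>\<eta>2\<close> to that from transmitter 2 at receiver 1. Their values do not
    matter, since they cancel in every sum used.\<close>
  have b: "\<exists>\<eta>1 \<eta>2. 
     r1 n \<le> 1 + n * Cap (a12 + a11 / (1 + a21)) + \<eta>1 - \<eta>2 \<and>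
     r1 n \<le> 1 + n * Cap (a11 + a12) - \<eta>2 \<and>
     r1 n \<le> 1 + n * Cap (a11 / (1 + a21)) + \<eta>1 \<and>
     r1 n \<le> 1 + n * Cap a11 \<and>
     r0 n + r1 n \<le> 1 + n * Cap ((cmod h11 + cmod h12)\<^sup>2) - \<eta>2 \<and>
     r0 n + r1 n \<le> 1 + n * Cap ((cmod h11 + cmod h12)\<^sup>2) \<and>
     r2 n \<le> 1 + n * Cap (a21 + a22 / (1 + a12)) + \<eta>2 - \<eta>1 \<and>
     r2 n \<le> 1 + n * Cap (a22 + a21) - \<eta>1 \<and>
     r2 n \<le> 1 + n * Cap (a22 / (1 + a12)) + \<eta>2 \<and>
     r2 n \<le> 1 + n * Cap a22 \<and>
     r0 n + r2 n \<le> 1 + n * Cap ((cmod h22 + cmod h21)\<^sup>2) - \<eta>1 \<and>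
     r0 n + r2 n \<le> 1 + n * Cap ((cmod h22 + cmod h21)\<^sup>2)" if n: "n > 0" and e1: "e n \<le> 1" for n
  proof -
    define M0 M1 M2 where "M0 = msize n R0" and "M1 = msize n R1" and "M2 = msize n R2"
    have M: "M0 > 0" "M1 > 0" "M2 > 0" by (simp_all add: M0_def M1_def M2_def msize_pos)
    have lnM: "n * R0 * ln 2 \<le> ln (card {1..M0})" "n * R1 * ln 2 \<le> ln (card {1..M1})"
      "n * R2 * ln 2 \<le> ln (card {1..M2})"
      by (simp_all add: M0_def M1_def M2_def ln_msize_ge)
    note c = code[of n, unfolded is_code_def, folded M0_def M1_def M2_def]
    have p1: "(\<Sum>m\<in>{1..M0}. \<Sum>k\<in>{1..M1}. \<Sum>t<n. (cmod (f1 n m k t))\<^sup>2) \<le> card {1..M0} * card {1..M1} * n"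
      using c n M by (intro power_constraint_sum) auto
    have p2: "(\<Sum>m\<in>{1..M0}. \<Sum>k\<in>{1..M2}. \<Sum>t<n. (cmod (f2 n m k t))\<^sup>2) \<le> card {1..M0} * card {1..M2} * n"
      using c n M by (intro power_constraint_sum) auto
    have g1[measurable]: "g1 n \<in> measurable (outspace n) (count_space UNIV)"
      and g2[measurable]: "g2 n \<in> measurable (outspace n) (count_space UNIV)"
      using c by auto
    interpret U1: receiver n "{1..M0}" "{1..M1}" "{1..M2}" "f1 n" "f2 n" "g1 n" h11 h12
      using M p1 p2 g1 by unfold_locales auto
    interpret U2: receiver n "{1..M0}" "{1..M2}" "{1..M1}" "f2 n" "f1 n" "g2 n" h22 h21
      using M p1 p2 g2 by unfold_locales auto
    interpret N: prob_space "noise n" by (rule prob_space_noise)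
    have r1[measurable]: "recv1 h11 h12 n (f1 n) (f2 n) m0 m1 m2 \<in> measurable (noise n) (outspace n)" for m0 m1 m2
      unfolding recv1_def[abs_def] outspace_def by (intro measurable_restrict) measurable
    have r2[measurable]: "recv2 h21 h22 n (f1 n) (f2 n) m0 m1 m2 \<in> measurable (noise n) (outspace n)" for m0 m1 m2
      unfolding recv2_def[abs_def] outspace_def by (intro measurable_restrict) measurable
    let ?S = "\<lambda>m0 m1 m2. {z \<in> space (noise n). g1 n (recv1 h11 h12 n (f1 n) (f2 n) m0 m1 m2 z) \<noteq> (m0, m1) \<or>
           g2 n (recv2 h21 h22 n (f1 n) (f2 n) m0 m1 m2 z) \<noteq> (m0, m2)}"
    have e_eq: "e n = (\<Sum>m0\<in>{1..M0}. \<Sum>m1\<in>{1..M1}. \<Sum>m2\<in>{1..M2}. measure (noise n) (?S m0 m1 m2)) / (M0 * M1 * M2)"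
      unfolding e_def err_prob_def M0_def M1_def M2_def by simp
    have eps1: "U1.eps \<le> e n"
    proof -
      have "measure (noise n) {z \<in> space (noise n). \<not> g1 n (\<lambda>t\<in>{..<n}. h11 * f1 n m0 m1 t + h12 * f2 n m0 m2 t + fst (z t)) = (m0, m1)}
          \<le> measure (noise n) (?S m0 m1 m2)" for m0 m1 m2
        by (intro N.finite_measure_mono) (auto simp: recv1_def)
      then show ?thesis
        unfolding U1.eps_def err_def e_eq by (auto intro!: divide_right_mono sum_mono)
    qed
    have eps2: "U2.eps \<le> e n"
    proof -
      have le: "measure (noise n) {z \<in> space (noise n). \<not> g2 n (\<lambda>t\<in>{..<n}. h22 * f2 n m0 m2 t + h21 * f1 n m0 m1 t + fst (z t)) = (m0, m2)}
          \<le> measure (noise n) (?S m0 m1 m2)" for m0 m1 m2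
      proof -
        have "measure (noise n) {z \<in> space (noise n). \<not> g2 n (\<lambda>t\<in>{..<n}. h22 * f2 n m0 m2 t + h21 * f1 n m0 m1 t + fst (z t)) = (m0, m2)}
          = measure (noise n) {z \<in> space (noise n). g2 n (recv2 h21 h22 n (f1 n) (f2 n) m0 m1 m2 z) \<noteq> (m0, m2)}"
        \<comment> \<open>\<open>recv2\<close> contains the second noise while \<open>err\<close>
          uses the first.\<close>
        proof (subst measure_noise_swap[symmetric])
          show "measure (noise n) {z \<in> space (noise n). \<not> g2 n (\<lambda>t\<in>{..<n}. h22 * f2 n m0 m2 t + h21 * f1 n m0 m1 t
              + fst ((\<lambda>t\<in>{..<n}. prod.swap (z t)) t)) = (m0, m2)}
            = measure (noise n) {z \<in> space (noise n). g2 n (recv2 h21 h22 n (f1 n) (f2 n) m0 m1 m2 z) \<noteq> (m0, m2)}"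
            by (simp add: recv2_def add.commute cong: restrict_cong)
        qed measurable
        also have "\<dots> \<le> measure (noise n) (?S m0 m1 m2)"
          by (intro N.finite_measure_mono) auto
        finally show ?thesis .
      qed
      have "(\<Sum>c\<in>{1..M0}. \<Sum>a\<in>{1..M2}. \<Sum>b\<in>{1..M1}. measure (noise n)
         {z \<in> space (noise n). \<not> g2 n (\<lambda>t\<in>{..<n}. h22 * f2 n c a t + h21 * f1 n c b t + fst (z t)) = (c, a)})
         \<le> (\<Sum>c\<in>{1..M0}. \<Sum>a\<in>{1..M2}. \<Sum>b\<in>{1..M1}. measure (noise n) (?S c b a))"
        by (intro sum_mono le)
      also have "\<dots> = (\<Sum>c\<in>{1..M0}. \<Sum>b\<in>{1..M1}. \<Sum>a\<in>{1..M2}. measure (noise n) (?S c b a))"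
        by (intro sum.cong refl sum.swap)
      finally show ?thesis
        unfolding U2.eps_def err_def e_eq by (auto intro!: divide_right_mono simp: mult_ac)
    qed
    \<comment> \<open>With \<open>g = h21\<close> at receiver 1 and \<open>g = h12\<close> at
      receiver 2, the side information of one receiver has the entropy of the interference at the
      other, so the same two numbers serve both.\<close>
    show ?thesis
      unfolding r0_def r1_def r2_def a11_def a12_def a21_def a22_def
      using U1.rate_bounds(1,3)[OF eps1 e1 lnM(1) lnM(2), of h21]
        U1.rate_bounds(2,4,5,6)[OF eps1 e1 lnM(1) lnM(2)]
        U2.rate_bounds(1,3)[OF eps2 e1 lnM(1) lnM(3), of h12]
        U2.rate_bounds(2,4,5,6)[OF eps2 e1 lnM(1) lnM(3)]
      by blast
  qed
  have lim': "e \<longlonglongrightarrow> 0" using lim by (simp add: e_def[abs_def])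
  have rate: "x * R0 + y * R1 + z * R2 \<le> Y"
    if "\<And>n. n > 0 \<Longrightarrow> e n \<le> 1 \<Longrightarrow> x * r0 n + y * r1 n + z * r2 n \<le> 3 + n * Y"
    for x y z Y :: real
  proof (rule rate_limit[OF lim'])
    fix n :: nat assume n: "n > 0" "e n \<le> 1"
    have "(1 - e n) * (n * (x * R0 + y * R1 + z * R2)) = x * r0 n + y * r1 n + z * r2 n"
      by (simp add: r0_def r1_def r2_def algebra_simps)
    then show "(1 - e n) * (n * (x * R0 + y * R1 + z * R2)) \<le> 3 + n * Y" using that[OF n] by simp
  qed
  \<comment> \<open>The first four inequalities use bounds free of \<open>\<eta>1\<close> and
    \<open>\<eta>2\<close>. In sums of two, the term with \<open>A1\<close> brings
    \<open>\<eta>1\<close> and its partner \<open>-\<eta>1\<close>, or the two \<open>E\<close>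
    terms cancel. In sums of three, such as \<open>A1 + G1 + E2\<close>, the contributions are
    \<open>\<eta>1\<close>, \<open>-\<eta>2\<close> and \<open>\<eta>2 - \<eta>1\<close>.\<close>
  have c0: "1 * R0 + 1 * R1 + 0 * R2 \<le> Cap ((cmod h11 + cmod h12)\<^sup>2)"
    by (rule rate) (drule (1) b, elim exE conjE, ((simp only: distrib_left)?; linarith))
  have c1: "1 * R0 + 0 * R1 + 1 * R2 \<le> Cap ((cmod h22 + cmod h21)\<^sup>2)"
    by (rule rate) (drule (1) b, elim exE conjE, ((simp only: distrib_left)?; linarith))
  have c2: "0 * R0 + 1 * R1 + 0 * R2 \<le> Cap a11"
    by (rule rate) (drule (1) b, elim exE conjE, ((simp only: distrib_left)?; linarith))
  have c3: "0 * R0 + 0 * R1 + 1 * R2 \<le> Cap a22"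
    by (rule rate) (drule (1) b, elim exE conjE, ((simp only: distrib_left)?; linarith))
  have c4: "0 * R0 + 1 * R1 + 1 * R2 \<le> Cap (a12 + a11 / (1 + a21)) + Cap (a21 + a22 / (1 + a12))"
    by (rule rate) (drule (1) b, elim exE conjE, ((simp only: distrib_left)?; linarith))
  have c5: "0 * R0 + 1 * R1 + 1 * R2 \<le> Cap (a11 / (1 + a21)) + Cap (a22 + a21)"
    by (rule rate) (drule (1) b, elim exE conjE, ((simp only: distrib_left)?; linarith))
  have c6: "0 * R0 + 1 * R1 + 1 * R2 \<le> Cap (a22 / (1 + a12)) + Cap (a11 + a12)"
    by (rule rate) (drule (1) b, elim exE conjE, ((simp only: distrib_left)?; linarith))
  have c7: "1 * R0 + 1 * R1 + 1 * R2 \<le> Cap (a11 / (1 + a21)) + Cap ((cmod h22 + cmod h21)\<^sup>2)"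
    by (rule rate) (drule (1) b, elim exE conjE, ((simp only: distrib_left)?; linarith))
  have c8: "1 * R0 + 1 * R1 + 1 * R2 \<le> Cap (a22 / (1 + a12)) + Cap ((cmod h11 + cmod h12)\<^sup>2)"
    by (rule rate) (drule (1) b, elim exE conjE, ((simp only: distrib_left)?; linarith))
  have c9: "0 * R0 + 2 * R1 + 1 * R2 \<le> Cap (a11 / (1 + a21)) + Cap (a11 + a12) + Cap (a21 + a22 / (1 + a12))"
    by (rule rate) (drule (1) b, elim exE conjE, ((simp only: distrib_left)?; linarith))
  have c10: "0 * R0 + 1 * R1 + 2 * R2 \<le> Cap (a22 / (1 + a12)) + Cap (a22 + a21) + Cap (a12 + a11 / (1 + a21))"
    by (rule rate) (drule (1) b, elim exE conjE, ((simp only: distrib_left)?; linarith))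
  have c11: "1 * R0 + 2 * R1 + 1 * R2 \<le> Cap (a11 / (1 + a21)) + Cap ((cmod h11 + cmod h12)\<^sup>2) + Cap (a21 + a22 / (1 + a12))"
    by (rule rate) (drule (1) b, elim exE conjE, ((simp only: distrib_left)?; linarith))
  have c12: "1 * R0 + 1 * R1 + 2 * R2 \<le> Cap (a22 / (1 + a12)) + Cap ((cmod h22 + cmod h21)\<^sup>2) + Cap (a12 + a11 / (1 + a21))"
    by (rule rate) (drule (1) b, elim exE conjE, ((simp only: distrib_left)?; linarith))
  show ?thesis
    unfolding outer_region_def Let_def a11_def[symmetric] a12_def[symmetric] a21_def[symmetric] a22_def[symmetric]
    using nonneg c0 c1 c2 c3 c4 c5 c6 c7 c8 c9 c10 c11 c12 by simp
qed

theorem theorem3: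
  fixes h11 h12 h21 h22 :: complex
  shows "capacity_region h11 h12 h21 h22 \<subseteq> outer_region h11 h12 h21 h22"
  unfolding capacity_region_def
  by (rule closure_minimal[OF _ closed_outer_region]) (auto intro: achievable_outer_region)

end
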